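(* Let $X\in\{B,C,D,C'\}$ and let $(\lambda,\mu)$ be a minimal special degeneration of type $X$. Consider the four minimal special degenerations $(\lambda,\mu)$, $(f(\lambda),f(\mu))$, $(d(\mu),d(\lambda))$, $(d_{LS}(\mu),d_{LS}(\lambda))$. Then their singularities form one of the three quartets: for a suitable choice of one of these four degenerations as initial degeneration $p$, there is $n\ge1$ such that the singularity types of $p$, of $f(p)$, of $d(p)$ and of $d_{LS}(p)$ are, respectively, one of $$(C_n,\ B_n,\ c_n^{sp},\ b_n^{sp}),\qquad (C_n,\ C_{n+1}^*,\ c_n^{sp},\ d_{n+1}^+),\qquad (C_n,\ [2B_n]^+,\ c_n^{sp},\ d_{n+1}/V_4).$$
   Context: For $\epsilon,\epsilon'\in\{0,1\}$, $\mathcal P_{\epsilon,\epsilon'}(N)$ is the set of partitions $\lambda$ of $N$ such that every part $s\equiv\epsilon\pmod2$ has even multiplicity and satisfies $h_\lambda(s):=\#\{j:\lambda_j\ge s\}\equiv\epsilon'\pmod 2$ ($s=0$ counted as a part, $h_\lambda(0)$ being the number of positive parts). Types: $B$: $(\epsilon,\epsilon')=(0,1)$, $N$ odd; $C$: $(1,0)$, $N$ even; $D$: $(0,0)$, $N$ even; $C'$ ("alternative special" in type $C$): $(1,1)$, $N$ even. They label special orbits in $\mathfrak{so}_N,\mathfrak{sp}_N,\mathfrak{so}_N$ (full orthogonal group) and alternative special orbits in $\mathfrak{sp}_N$. A minimal special degeneration of type $X$ is a pair $(\lambda,\mu)$ of elements of $\mathcal P_{\epsilon,\epsilon'}(N)$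 adjacent in dominance order, $\mu<\lambda$. Maps: $d(\lambda)=\lambda^*$ (transpose), mapping $B\to B$, $C\to C$, $D\leftrightarrow C'$. For a partition $\lambda=[\lambda_1,\dots,\lambda_k]$, $\lambda^-$ is obtained by lowering the last part $\lambda_k$ by one, $\lambda^+$ by raising $\lambda_1$ by one, and $\lambda_Y$ ($Y=B,C,D$) is the $Y$-collapse (the dominance-largest partition $\preceq\lambda$ with even (for $Y=B,D$), resp. odd (for $Y=C$), parts of even multiplicity). Then $f(\lambda)=(\lambda^-)_C$ from $B$ to $C$, $f(\lambda)=(\lambda^+)_B$ from $C$ to $B$, $f(\lambda)=((\lambda^+)^-)_C$ from $D$ to $C'$, $f(\lambda)=\lambda_D$ from $C'$ to $D$. $d_{LS}=d\circ f=f\circ d$. For $p=(\lambda,\mu)$: $f(p)=(f(\lambda),f(\mu))$, $d(p)=(d(\mu),d(\lambda))$, $d_{LS}(p)=(d_{LS}(\mu),d_{LS}(\lambda))$. Singularity types: remove from $(\lambda,\mu)$ all common initial rows ($l$ of them) and then all common initial columns ($s$ of them). The remaining pair determines the type: $([2],[1,1])$: $C_1$. $([2n],[2n-2,2])$, $n\ge2$, $s\not\equiv\epsilon$: $C_n$, written $C_n^*$ if $l\not\equiv\epsilon'$. $([2n+1],[2n-1,1,1])$ with $s\equiv\epsilon$, or $([2n+1,2n+1],[2n,2n,2])$ with $s\not\equiv\epsilon$, $n\ge1$: $B_n$. $([2n,2n],[2n-1,2n-1,1,1])$, $s\equiv\epsilon$: $[2B_n]^+$. $([2^2,1^{2n-4}],[1^{2n}])$,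 $n\ge2$: $c_n^{sp}$ if $s\not\equiv\epsilon$, $d_n^+$ if $s\equiv\epsilon$. $([3,1^{2n-2}],[1^{2n+1}])$ with $s\equiv\epsilon$, or $([3^2,2^{2n-2}],[2^{2n+1}])$ with $s\not\equiv\epsilon$, $n\ge2$: $b_n^{sp}$. $([4,2^{2n-2}],[2^{2n}])$, $n\ge2$, $s\not\equiv\epsilon$: $d_{n+1}/V_4$. Conventions for small rank: $c_1^{sp}=C_1$ and $b_1^{sp}=B_1$ (all type $A_1$), $d_2^+$ coincides with $[2B_1]^+$, and $d_2/V_4$ is to be read as $C_2^*$ (the pair $([4],[2,2])$). Meaning of the symbols: $C_n$ is a $D_{n+1}$ surface singularity, $B_n$ an $A_{2n-1}$ surface singularity, each with $\mathfrak S_2$ outer action of $A(e)$; the star indicates that the kernel of the map from $A(e)$ to Lusztig's canonical quotient acts by outer action; $[2B_n]^+$ is a union of two $A_{2n-1}$'s with Klein four-group action; $b_n^{sp},c_n^{sp}$ are closures of minimal special nilpotent orbits in $\mathfrak{so}_{2n+1},\mathfrak{sp}_{2n}$; $d_n^+$ is the closure of the minimal nilpotent orbit of $\mathfrak{so}_{2n}$ with outer $\mathfrak S_2$-action; $d_{n+1}/V_4$ is the quotient of the closure of the minimal nilpotent orbit of $\mathfrak{so}_{2n+2}$ by the group generated by conjugation by $\mathrm{diag}(1,\dots,1,-1)$ and $\mathrm{diag}(1,\dots,1,-1,1)$. *)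

theory Defs
  imports Main "HOL-Library.Sublist"
begin

section \<open>Partitions and dominance\<close>

text \<open>A partition is the weakly decreasing list of its positive parts.\<close>

definition is_partition :: "nat \<Rightarrow> nat list \<Rightarrow> bool" where
  "is_partition N lam \<longleftrightarrow> sorted_wrt (\<ge>) lam \<and> 0 \<notin> set lam \<and> sum_list lam = N"

definition height :: "nat list \<Rightarrow> nat \<Rightarrow> nat" where
  "height lam s = length (filter (\<lambda>x. s \<le> x) lam)"

definition largest_part :: "nat list \<Rightarrow> nat" where
  "largest_part lam = (case lam of [] \<Rightarrow> 0 | x # _ \<Rightarrow> x)"

definition conjugate :: "nat list \<Rightarrow> nat list" where
  "conjugate lam = map (height lam) [1..<Suc (largest_part lam)]"

definition dominated :: "nat list \<Rightarrow> nat list \<Rightarrow> bool"  (infix "\<unlhd>" 50) where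
  "mu \<unlhd> lam \<longleftrightarrow>
     sum_list mu = sum_list lam \<and> (\<forall>i. sum_list (take i mu) \<le> sum_list (take i lam))"

section \<open>Special partitions\<close>

datatype lie_type = Type_B | Type_C | Type_D | Type_C'

fun eps :: "lie_type \<Rightarrow> nat" where
  "eps Type_B = 0" | "eps Type_C = 1" | "eps Type_D = 0" | "eps Type_C' = 1"

fun eps' :: "lie_type \<Rightarrow> nat" where
  "eps' Type_B = 1" | "eps' Type_C = 0" | "eps' Type_D = 0" | "eps' Type_C' = 1"

fun size_parity :: "lie_type \<Rightarrow> nat" where
  "size_parity Type_B = 1" | "size_parity Type_C = 0"
| "size_parity Type_D = 0" | "size_parity Type_C' = 0"

definition nilpotent_partition :: "nat \<Rightarrow> nat \<Rightarrow> nat list \<Rightarrow> bool" where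
  "nilpotent_partition \<epsilon> N lam \<longleftrightarrow>
     is_partition N lam \<and> (\<forall>s\<in>set lam. s mod 2 = \<epsilon> \<longrightarrow> even (count_list lam s))"

text \<open>The height condition is also imposed at \<open>s = 0\<close>, where the height is the number of
  positive parts; it is only effective there when \<open>\<epsilon> = 0\<close>.\<close>

definition special_partition :: "lie_type \<Rightarrow> nat \<Rightarrow> nat list \<Rightarrow> bool" where
  "special_partition X N lam \<longleftrightarrow>
     N mod 2 = size_parity X \<and> nilpotent_partition (eps X) N lam \<and>
     (\<forall>s\<in>insert 0 (set lam). s mod 2 = eps X \<longrightarrow> height lam s mod 2 = eps' X)"

text \<open>A pair \<open>(lam, mu)\<close> together with the type in which it is considered.\<close>

type_synonym degeneration = "lie_type \<times> nat list \<times> nat list"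

fun minimal_special_degeneration :: "degeneration \<Rightarrow> bool" where
  "minimal_special_degeneration (X, lam, mu) \<longleftrightarrow>
     (\<exists>N. special_partition X N lam \<and> special_partition X N mu \<and> mu \<unlhd> lam \<and> mu \<noteq> lam \<and>
          (\<forall>\<nu>. special_partition X N \<nu> \<and> mu \<unlhd> \<nu> \<and> \<nu> \<unlhd> lam \<longrightarrow> \<nu> = mu \<or> \<nu> = lam))"

section \<open>The duality maps\<close>

definition lower_last :: "nat list \<Rightarrow> nat list" where
  "lower_last lam =
     (if lam = [] then [] else if last lam = 1 then butlast lam else butlast lam @ [last lam - 1])"

fun raise_first :: "nat list \<Rightarrow> nat list" where
  "raise_first [] = [1]"
| "raise_first (x # xs) = Suc x # xs"

text \<open>The \<open>B\<close>- and the \<open>D\<close>-collapse are given by the same condition (\<open>\<epsilon> = 0\<close>); they only differ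
  in the parity of the size, which collapsing preserves.\<close>

definition collapse :: "lie_type \<Rightarrow> nat list \<Rightarrow> nat list" where
  "collapse Y lam =
     (THE \<nu>. nilpotent_partition (eps Y) (sum_list lam) \<nu> \<and> \<nu> \<unlhd> lam \<and>
        (\<forall>\<kappa>. nilpotent_partition (eps Y) (sum_list lam) \<kappa> \<and> \<kappa> \<unlhd> lam \<longrightarrow> \<kappa> \<unlhd> \<nu>))"

fun f_type :: "lie_type \<Rightarrow> lie_type" where
  "f_type Type_B = Type_C" | "f_type Type_C = Type_B"
| "f_type Type_D = Type_C'" | "f_type Type_C' = Type_D"

fun f_map :: "lie_type \<Rightarrow> nat list \<Rightarrow> nat list" where
  "f_map Type_B lam = collapse Type_C (lower_last lam)"
| "f_map Type_C lam = collapse Type_B (raise_first lam)"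
| "f_map Type_D lam = collapse Type_C (lower_last (raise_first lam))"
| "f_map Type_C' lam = collapse Type_D lam"

fun d_type :: "lie_type \<Rightarrow> lie_type" where
  "d_type Type_B = Type_B" | "d_type Type_C = Type_C"
| "d_type Type_D = Type_C'" | "d_type Type_C' = Type_D"

definition d_LS_map :: "lie_type \<Rightarrow> nat list \<Rightarrow> nat list" where
  "d_LS_map X lam = conjugate (f_map X lam)"

fun f_deg :: "degeneration \<Rightarrow> degeneration" where
  "f_deg (X, lam, mu) = (f_type X, f_map X lam, f_map X mu)"

fun d_deg :: "degeneration \<Rightarrow> degeneration" where
  "d_deg (X, lam, mu) = (d_type X, conjugate mu, conjugate lam)"

fun d_LS_deg :: "degeneration \<Rightarrow> degeneration" where
  "d_LS_deg (X, lam, mu) = (d_type (f_type X), d_LS_map X mu, d_LS_map X lam)"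

section \<open>Singularity types\<close>

text \<open>
  \<^item> \<open>Sing_C n\<close>, \<open>Sing_C_star n\<close>: \<open>C\<^sub>n\<close> and \<open>C\<^sub>n\<^sup>*\<close> (surface singularity \<open>D\<^bsub>n+1\<^esub>\<close>);
  \<^item> \<open>Sing_B n\<close>: \<open>B\<^sub>n\<close> (surface singularity \<open>A\<^bsub>2n-1\<^esub>\<close>);
  \<^item> \<open>Sing_2B_plus n\<close>: \<open>[2B\<^sub>n]\<^sup>+\<close> (union of two \<open>A\<^bsub>2n-1\<^esub>\<close>);
  \<^item> \<open>Sing_b_sp n\<close>, \<open>Sing_c_sp n\<close>: closures of the minimal special nilpotent orbits of
    \<open>so\<^bsub>2n+1\<^esub>\<close> and \<open>sp\<^bsub>2n\<^esub>\<close>;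
  \<^item> \<open>Sing_d_plus n\<close>: closure of the minimal nilpotent orbit of \<open>so\<^bsub>2n\<^esub>\<close>, with outer action;
  \<^item> \<open>Sing_d_mod_V4 n\<close>: \<open>d\<^sub>n/V\<^sub>4\<close>, a quotient of the closure of the minimal nilpotent orbit
    of \<open>so\<^bsub>2n\<^esub>\<close> by a Klein four-group.
\<close>

datatype singularity =
    Sing_C nat | Sing_C_star nat | Sing_B nat | Sing_2B_plus nat
  | Sing_b_sp nat | Sing_c_sp nat | Sing_d_plus nat | Sing_d_mod_V4 nat

definition common_prefix_length :: "'a list \<Rightarrow> 'a list \<Rightarrow> nat" where
  "common_prefix_length xs ys = length (longest_common_prefix xs ys)"

definition common_rows :: "nat list \<Rightarrow> nat list \<Rightarrow> nat" where
  "common_rows lam mu = common_prefix_length lam mu"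

definition common_columns :: "nat list \<Rightarrow> nat list \<Rightarrow> nat" where
  "common_columns lam mu = common_prefix_length (conjugate lam) (conjugate mu)"

definition remove_columns :: "nat \<Rightarrow> nat list \<Rightarrow> nat list" where
  "remove_columns s lam = conjugate (drop s (conjugate lam))"

text \<open>\<open>reduced_singularity X l s lam mu t\<close>: a degeneration of type \<open>X\<close> for which the removal of
  \<open>l\<close> common rows and then \<open>s\<close> common columns leaves \<open>(lam, mu)\<close> has singularity \<open>t\<close>.
  The last three rules are the identifications \<open>c\<^sub>1 = C\<^sub>1\<close>, \<open>b\<^sub>1 = B\<^sub>1\<close> (special versions) and
  \<open>d\<^sub>2/V\<^sub>4 = C\<^sub>2\<^sup>*\<close> in small rank; the identification of \<open>d\<^sub>2\<^sup>+\<close> with \<open>[2B\<^sub>1]\<^sup>+\<close> needs no rule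
  because the two families share the pair \<open>([2,2], [1,1,1,1])\<close>.\<close>

inductive reduced_singularity ::
  "lie_type \<Rightarrow> nat \<Rightarrow> nat \<Rightarrow> nat list \<Rightarrow> nat list \<Rightarrow> singularity \<Rightarrow> bool"
  for X :: lie_type and l s :: nat
where
  C_1: "reduced_singularity X l s [2] [1, 1] (Sing_C 1)"
| C_n: "\<lbrakk>n \<ge> 2; s mod 2 \<noteq> eps X; l mod 2 = eps' X\<rbrakk> \<Longrightarrow>
    reduced_singularity X l s [2*n] [2*n - 2, 2] (Sing_C n)"
| C_n_star: "\<lbrakk>n \<ge> 2; s mod 2 \<noteq> eps X; l mod 2 \<noteq> eps' X\<rbrakk> \<Longrightarrow>
    reduced_singularity X l s [2*n] [2*n - 2, 2] (Sing_C_star n)"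
| B_n_row: "\<lbrakk>n \<ge> 1; s mod 2 = eps X\<rbrakk> \<Longrightarrow>
    reduced_singularity X l s [2*n + 1] [2*n - 1, 1, 1] (Sing_B n)"
| B_n_two_rows: "\<lbrakk>n \<ge> 1; s mod 2 \<noteq> eps X\<rbrakk> \<Longrightarrow>
    reduced_singularity X l s [2*n + 1, 2*n + 1] [2*n, 2*n, 2] (Sing_B n)"
| two_B_n: "\<lbrakk>n \<ge> 1; s mod 2 = eps X\<rbrakk> \<Longrightarrow>
    reduced_singularity X l s [2*n, 2*n] [2*n - 1, 2*n - 1, 1, 1] (Sing_2B_plus n)"
| c_n_sp: "\<lbrakk>n \<ge> 2; s mod 2 \<noteq> eps X\<rbrakk> \<Longrightarrow>
    reduced_singularity X l s ([2, 2] @ replicate (2*n - 4) 1) (replicate (2*n) 1) (Sing_c_sp n)"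
| d_n_plus: "\<lbrakk>n \<ge> 2; s mod 2 = eps X\<rbrakk> \<Longrightarrow>
    reduced_singularity X l s ([2, 2] @ replicate (2*n - 4) 1) (replicate (2*n) 1) (Sing_d_plus n)"
| b_n_sp_one: "\<lbrakk>n \<ge> 2; s mod 2 = eps X\<rbrakk> \<Longrightarrow>
    reduced_singularity X l s (3 # replicate (2*n - 2) 1) (replicate (2*n + 1) 1) (Sing_b_sp n)"
| b_n_sp_two: "\<lbrakk>n \<ge> 2; s mod 2 \<noteq> eps X\<rbrakk> \<Longrightarrow>
    reduced_singularity X l s ([3, 3] @ replicate (2*n - 2) 2) (replicate (2*n + 1) 2) (Sing_b_sp n)"
| d_mod_V4: "\<lbrakk>n \<ge> 2; s mod 2 \<noteq> eps X\<rbrakk> \<Longrightarrow>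
    reduced_singularity X l s (4 # replicate (2*n - 2) 2) (replicate (2*n) 2) (Sing_d_mod_V4 (n + 1))"
| c_1_sp: "reduced_singularity X l s lam mu (Sing_C 1) \<Longrightarrow>
    reduced_singularity X l s lam mu (Sing_c_sp 1)"
| b_1_sp: "reduced_singularity X l s lam mu (Sing_B 1) \<Longrightarrow>
    reduced_singularity X l s lam mu (Sing_b_sp 1)"
| d_2_mod_V4: "reduced_singularity X l s lam mu (Sing_C_star 2) \<Longrightarrow>
    reduced_singularity X l s lam mu (Sing_d_mod_V4 2)"

fun has_singularity :: "degeneration \<Rightarrow> singularity \<Rightarrow> bool" where
  "has_singularity (X, lam, mu) t \<longleftrightarrow>
     (let l = common_rows lam mu; lam' = drop l lam; mu' = drop l mu; s = common_columns lam' mu'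
      in reduced_singularity X l s (remove_columns s lam') (remove_columns s mu') t)"

end

theory Submission
  imports Defs "HOL-Library.More_List"
begin

text \<open>
  Let \<open>S j\<close> be the partial sums of a special partition of type \<open>X\<close>. Halving them gives a sequence
  \<open>T\<close>, and in terms of suitably shifted second differences \<open>d j\<close> of \<open>T\<close>, the \<^emph>\<open>defects\<close>, the special
  partitions of type \<open>X\<close> are exactly the sequences whose defects are nonnegative and have no two
  consecutive zeros. The dominance order becomes the pointwise order of \<open>T\<close>. (The sequence \<open>d\<close>
  consists of the differences of the entries of the special symbol of the partition.) The map
  \<open>f\<close> flips both parities \<open>\<epsilon>\<close> and \<open>\<epsilon>'\<close>; this leaves the defects unchanged, and \<open>f\<close> is the map that
  preserves \<open>T\<close>, hence an isomorphism of posets. Transposition is an anti-isomorphism.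

  In the poset of the sequences \<open>T\<close> every cover lowers \<open>T\<close> by one, either at a single \<open>j\<close> with
  \<open>d j \<ge> 2\<close>, or on an interval where \<open>d\<close> reads \<open>1, 1, 0, 1, 0, \<dots>, 0, 1, 1\<close>. In a cover of the first
  kind with \<open>d j = n + 1\<close>, the degeneration has type \<open>C\<^sub>n\<close> if \<open>j\<close> is not congruent to \<open>\<epsilon>'\<close>; otherwise
  the type is \<open>C\<^sup>*\<^bsub>n+1\<^esub>\<close>, \<open>B\<^sub>n\<close> or \<open>[2B\<^sub>n]\<^sup>+\<close>, according to how many of \<open>d (j - 1)\<close> and \<open>d (j + 1)\<close>
  vanish. Since \<open>f\<close> exchanges the two parities of \<open>j\<close>, this gives the types of \<open>p\<close> and \<open>f p\<close>, and
  those of \<open>d p\<close> and \<open>d\<^sub>L\<^sub>S p\<close> follow by transposition. Transposition turns a cover of the second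
  kind into one of the first kind.
\<close>

section \<open>Partial sums, conjugation and dominance\<close>

abbreviation row :: "nat list \<Rightarrow> nat \<Rightarrow> nat" where
  "row \<equiv> nth_default 0"

text \<open>Integer-valued, so that first and second differences are not truncated.\<close>

definition psum :: "nat list \<Rightarrow> nat \<Rightarrow> int" where
  "psum lam j = int (sum_list (take j lam))"

lemma psum_0 [simp]: "psum lam 0 = 0"
  by (simp add: psum_def)

lemma psum_Suc: "psum lam (Suc j) = psum lam j + int (row lam j)"
  by (cases "j < length lam")
    (simp_all add: psum_def take_Suc_conv_app_nth nth_default_def)

lemma psum_eventually: "length lam \<le> j \<Longrightarrow> psum lam j = int (sum_list lam)"
  by (simp add: psum_def)

lemma psum_mono: "i \<le> j \<Longrightarrow> psum lam i \<le> psum lam j"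
  by (rule lift_Suc_mono_le) (simp_all add: psum_Suc)

lemma psum_le_total: "psum lam j \<le> int (sum_list lam)"
  using psum_mono[of j "max j (length lam)" lam] by (simp add: psum_eventually)

lemma dominated_iff_psum:
  "mu \<unlhd> lam \<longleftrightarrow> sum_list mu = sum_list lam \<and> (\<forall>j. psum mu j \<le> psum lam j)"
  by (simp add: dominated_def psum_def)

lemma partition_row_antimono:
  assumes "is_partition N lam" "i \<le> j"
  shows "row lam j \<le> row lam i"
proof (cases "i < j \<and> j < length lam")
  case True
  with assms show ?thesis
    by (auto simp: is_partition_def nth_default_def sorted_wrt_iff_nth_less)
next
  case False
  with assms(2) show ?thesis
    by (cases "i = j") (auto simp: nth_default_def)
qed

lemma partition_row_pos:
  assumes "is_partition N lam"
  shows "0 < row lam i \<longleftrightarrow> i < length lam"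
  using assms nth_mem[of i lam] by (cases "lam ! i") (auto simp: is_partition_def nth_default_def)

lemma partition_eqI:
  assumes "is_partition N lam" "is_partition M mu" "\<And>i. row lam i = row mu i"
  shows "lam = mu"
proof (rule nth_equalityI)
  have "i < length lam \<longleftrightarrow> i < length mu" for i
    using partition_row_pos[OF assms(1), of i] partition_row_pos[OF assms(2), of i] assms(3)
    by simp
  then show len: "length lam = length mu"
    by (meson linorder_neqE_nat less_irrefl)
  fix i assume "i < length lam"
  with len assms(3)[of i] show "lam ! i = mu ! i"
    by (simp add: nth_default_def)
qed

lemma partition_eqI_psum:
  assumes "is_partition N lam" "is_partition M mu" "\<And>j. psum lam j = psum mu j"
  shows "lam = mu"
proof (rule partition_eqI[OF assms(1,2)])
  fix i
  show "row lam i = row mu i"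
    using assms(3)[of i] assms(3)[of "Suc i"] by (simp add: psum_Suc)
qed

lemma partition_sum: "is_partition N lam \<Longrightarrow> sum_list lam = N"
  by (simp add: is_partition_def)

lemma psum_concave:
  assumes "is_partition N lam"
  shows "psum lam j + psum lam (Suc (Suc j)) \<le> 2 * psum lam (Suc j)"
  using partition_row_antimono[OF assms, of j "Suc j"] by (simp add: psum_Suc)

lemma partition_of_rows:
  assumes anti: "\<And>i. r (Suc i) \<le> r i" and ev: "\<And>i. M \<le> i \<Longrightarrow> r i = (0::nat)"
  obtains lam where "is_partition (sum_list lam) lam" "row lam = r"
proof -
  define L where "L = (LEAST i. r i = 0)"
  have L0: "r L = 0"
    unfolding L_def using ev[of M] by (intro LeastI[of "\<lambda>i. r i = 0" M]) simp
  have pos: "0 < r i" if "i < L" for i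
    using not_less_Least[of i "\<lambda>i. r i = 0"] that by (auto simp: L_def)
  have mono: "r j \<le> r i" if "i \<le> j" for i j
    using lift_Suc_antimono_le[of r i j] anti that by blast
  let ?lam = "map r [0..<L]"
  have "is_partition (sum_list ?lam) ?lam"
    using mono by (auto simp: is_partition_def sorted_wrt_iff_nth_less) (metis pos less_irrefl)
  moreover have "row ?lam = r"
  proof
    fix i
    show "row ?lam i = r i"
      using mono[of L i] L0 by (cases "i < L") (auto simp: nth_default_def)
  qed
  ultimately show ?thesis
    using that by blast
qed

lemma partition_of_psum:
  assumes S0: "S 0 = (0::int)"
    and conc: "\<And>j. S j + S (Suc (Suc j)) \<le> 2 * S (Suc j)"
    and ev: "\<And>j. M \<le> j \<Longrightarrow> S j = int N"
  obtains lam where "is_partition N lam" "psum lam = S"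
proof -
  have anti: "S (Suc j) - S j \<le> S (Suc i) - S i" if "i \<le> j" for i j
    using lift_Suc_antimono_le[of "\<lambda>i. S (Suc i) - S i" i j] conc that
    by (smt (verit, ccfv_SIG))
  \<comment> \<open>The increments decrease and are eventually \<open>0\<close>, so none of them is
    negative.\<close>
  have nonneg: "0 \<le> S (Suc i) - S i" for i
    using anti[of i "max i M"] ev[of "max i M"] ev[of "Suc (max i M)"] by simp
  define r where "r i = nat (S (Suc i) - S i)" for i
  obtain lam where lam: "is_partition (sum_list lam) lam" "row lam = r"
  proof (rule partition_of_rows)
    show "r (Suc i) \<le> r i" for i
      using conc[of i] by (simp add: r_def nat_le_eq_zle)
    show "r i = 0" if "M \<le> i" for i
      using that ev[of i] ev[of "Suc i"] by (simp add: r_def)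
  qed
  have ps: "psum lam j = S j" for j
    by (induction j) (use nonneg in \<open>simp_all add: S0 psum_Suc lam r_def\<close>)
  have "int (sum_list lam) = int N"
    using ps[of "max (length lam) M"] ev[of "max (length lam) M"] by (simp add: psum_eventually)
  with lam ps that show ?thesis
    by (metis ext of_nat_eq_iff)
qed

section \<open>Conjugate partitions\<close>

lemma sorted_filter_ge:
  assumes "sorted_wrt (\<ge>) (lam :: nat list)"
  shows "filter (\<lambda>x. s \<le> x) lam = take (height lam s) lam"
  using assms
proof (induction lam)
  case (Cons x xs)
  show ?case
  proof (cases "s \<le> x")
    case False
    with Cons.prems have "filter (\<lambda>y. s \<le> y) (x # xs) = []"
      by (auto simp: filter_empty_conv)
    then show ?thesis by (simp add: height_def)
  qed (use Cons in \<open>simp add: height_def\<close>)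
qed (simp add: height_def)

text \<open>Both sides say that the cell in row \<open>i\<close> and column \<open>s\<close>,
  counted from \<open>0\<close>, lies in the Young diagram.\<close>

lemma less_height_iff:
  assumes "is_partition N lam"
  shows "i < height lam (Suc s) \<longleftrightarrow> s < row lam i"
proof -
  have sorted: "sorted_wrt (\<ge>) lam"
    using assms by (simp add: is_partition_def)
  have le: "height lam (Suc s) \<le> length lam"
    by (simp add: height_def)
  have t: "take (height lam (Suc s)) lam = filter (\<lambda>x. Suc s \<le> x) lam"
    using sorted_filter_ge[OF sorted] by simp
  show ?thesis
  proof
    assume i: "i < height lam (Suc s)"
    then have "lam ! i \<in> set (take (height lam (Suc s)) lam)"
      using le nth_mem[of i "take (height lam (Suc s)) lam"] by simp
    with t have "Suc s \<le> lam ! i" by auto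
    with i le show "s < row lam i" by (simp add: nth_default_def)
  next
    assume s: "s < row lam i"
    have i: "i < length lam"
      using s by (auto simp: nth_default_def split: if_splits)
    have "Suc s \<le> row lam k" if "k \<le> i" for k
      using partition_row_antimono[OF assms that] s by simp
    then have "filter (\<lambda>x. Suc s \<le> x) (take (Suc i) lam) = take (Suc i) lam"
      using i by (auto simp: filter_id_conv in_set_conv_nth nth_default_def)
    then have "Suc i \<le> length (filter (\<lambda>x. Suc s \<le> x) (take (Suc i) lam @ drop (Suc i) lam))"
      using i unfolding filter_append by simp
    then show "i < height lam (Suc s)"
      by (simp add: height_def)
  qed
qed

lemma row_conjugate:
  assumes "is_partition N lam"
  shows "row (conjugate lam) j = height lam (Suc j)"
proof (cases "j < largest_part lam")
  case True
  then show ?thesis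
    by (simp add: conjugate_def nth_default_def del: upt_Suc)
next
  case False
  have "row lam 0 = largest_part lam"
    by (cases lam) (simp_all add: largest_part_def)
  with False less_height_iff[OF assms, of 0 j] have "height lam (Suc j) = 0"
    by simp
  with False show ?thesis
    by (simp add: conjugate_def nth_default_def)
qed

lemma less_row_conjugate_iff:
  assumes "is_partition N lam"
  shows "i < row (conjugate lam) j \<longleftrightarrow> j < row lam i"
  using assms by (simp add: row_conjugate less_height_iff)

lemma height_conv_sum: "height lam (Suc j) = sum_list (map (\<lambda>x. min (Suc j) x - min j x) lam)"
  by (induction lam) (auto simp: height_def)

text \<open>Counts the cells in the first \<open>j\<close> columns row by row: a part
  \<open>x\<close> contributes \<open>min j x\<close>.\<close>

lemma psum_conjugate:
  assumes "is_partition N lam"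
  shows "psum (conjugate lam) j = int (sum_list (map (min j) lam))"
proof (induction j)
  case (Suc j)
  have "sum_list (map (min (Suc j)) xs)
      = sum_list (map (min j) xs) + sum_list (map (\<lambda>x. min (Suc j) x - min j x) xs)" for xs
    by (induction xs) auto
  with Suc show ?case
    by (simp add: psum_Suc row_conjugate[OF assms] height_conv_sum)
qed (induction lam, auto)

lemma conjugate_partition:
  assumes "is_partition N lam"
  shows "is_partition N (conjugate lam)"
proof -
  have large: "x \<le> largest_part lam" if "x \<in> set lam" for x
    using assms that by (cases lam) (auto simp: is_partition_def largest_part_def)
  have anti: "height lam t \<le> height lam s" if "s \<le> t" for s t
    using that unfolding height_def by (induction lam) auto
  have "height lam s \<noteq> 0" if s: "1 \<le> s" "s < Suc (largest_part lam)" for s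
  proof -
    obtain x xs where "lam = x # xs" "s \<le> x"
      using s by (cases lam) (auto simp: largest_part_def)
    then show ?thesis by (simp add: height_def)
  qed
  then have "0 \<notin> set (conjugate lam)"
    unfolding conjugate_def by (smt (verit) atLeastLessThan_iff in_set_conv_nth length_map list.set_map imageE set_upt)
  moreover have "sorted_wrt (\<ge>) (conjugate lam)"
    using anti by (auto simp: conjugate_def sorted_wrt_iff_nth_less simp del: upt_Suc)
  moreover have "sum_list (conjugate lam) = sum_list (map (min (largest_part lam)) lam)"
    using psum_conjugate[OF assms, of "largest_part lam"] psum_eventually[of "conjugate lam" "largest_part lam"]
    by (simp add: conjugate_def)
  moreover have "map (min (largest_part lam)) lam = lam"
    using large by (intro map_idI) auto
  ultimately show ?thesis
    using assms by (simp add: is_partition_def)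
qed

lemma conjugate_conjugate:
  assumes "is_partition N lam"
  shows "conjugate (conjugate lam) = lam"
proof (rule partition_eqI[OF _ assms])
  show c: "is_partition N (conjugate (conjugate lam))"
    by (intro conjugate_partition assms)
  fix i
  have "k < row (conjugate (conjugate lam)) i \<longleftrightarrow> k < row lam i" for k
    by (simp add: less_row_conjugate_iff[OF conjugate_partition[OF assms]] less_row_conjugate_iff[OF assms])
  then show "row (conjugate (conjugate lam)) i = row lam i"
    by (meson linorder_neqE_nat less_irrefl)
qed

text \<open>Cut the first \<open>k\<close> rows after column \<open>j\<close>: at most
  \<open>k * j\<close> cells are on the left, the others are among all cells on the right. With
  equality at \<open>k = height lam (Suc j)\<close>, the number of cells on the right is the maximum
  of \<open>psum lam k - k * j\<close> over \<open>k\<close>.\<close>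

lemma psum_le_excess: "psum lam k \<le> int (k * j) + int (sum_list (map (\<lambda>x. x - j) lam))"
proof (induction lam arbitrary: k)
  case (Cons x xs)
  show ?case
  proof (cases k)
    case (Suc k')
    have "int x \<le> int j + int (x - j)" by simp
    with Cons.IH[of k'] show ?thesis
      by (simp add: Suc psum_def algebra_simps)
  qed simp
qed (simp add: psum_def)

lemma psum_eq_excess:
  assumes "sorted_wrt (\<ge>) lam"
  shows "psum lam (height lam (Suc j)) = int (height lam (Suc j) * j) + int (sum_list (map (\<lambda>x. x - j) lam))"
proof -
  have *: "filter (\<lambda>x. Suc j \<le> x) lam = take (height lam (Suc j)) lam"
    by (rule sorted_filter_ge[OF assms])
  have "sum_list (filter (\<lambda>x. Suc j \<le> x) xs)
      = height xs (Suc j) * j + sum_list (map (\<lambda>x. x - j) xs)" for xs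
    by (induction xs) (auto simp: height_def)
  then show ?thesis
    unfolding psum_def *[symmetric] by simp
qed

text \<open>The number of cells outside the first \<open>j\<close> columns is a maximum of
  expressions increasing in the partial sums, hence monotone in dominance; the cells in the first
  \<open>j\<close> columns are the complement.\<close>

lemma conjugate_dominated:
  assumes "is_partition N lam" "is_partition N mu" "mu \<unlhd> lam"
  shows "conjugate lam \<unlhd> conjugate mu"
proof -
  have split: "sum_list (map (min j) xs) + sum_list (map (\<lambda>x. x - j) xs) = sum_list xs" for j and xs :: "nat list"
  proof -
    have "sum_list (map (min j) xs) + sum_list (map (\<lambda>x. x - j) xs)
        = sum_list (map (\<lambda>x. min j x + (x - j)) xs)"
      by (rule sum_list_addf[symmetric])
    also have "map (\<lambda>x. min j x + (x - j)) xs = xs"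
      by (rule map_idI) simp
    finally show ?thesis .
  qed
  have "psum (conjugate lam) j \<le> psum (conjugate mu) j" for j
  proof -
    let ?k = "height mu (Suc j)"
    have "int (?k * j) + int (sum_list (map (\<lambda>x. x - j) mu)) = psum mu ?k"
      using assms(2) by (simp add: psum_eq_excess is_partition_def)
    also have "\<dots> \<le> psum lam ?k"
      using assms(3) by (simp add: dominated_iff_psum)
    also have "\<dots> \<le> int (?k * j) + int (sum_list (map (\<lambda>x. x - j) lam))"
      by (rule psum_le_excess)
    finally show ?thesis
      using split[of j lam] split[of j mu] partition_sum[OF assms(1)] partition_sum[OF assms(2)]
      by (simp add: psum_conjugate[OF assms(1)] psum_conjugate[OF assms(2)])
  qed
  then show ?thesis
    using assms by (simp add: dominated_iff_psum partition_sum[OF conjugate_partition])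
qed

section \<open>Special partitions through parities of partial sums\<close>

lemma even_sum_list_map:
  fixes g :: "'a \<Rightarrow> nat"
  assumes "\<And>v. v \<in> set xs \<Longrightarrow> odd (g v) \<Longrightarrow> even (count_list xs v)"
  shows "even (sum_list (map g xs))"
  unfolding sum_list_map_eq_sum_count using assms by (intro dvd_sum) auto

lemma count_list_filter: "count_list (filter P xs) v = (if P v then count_list xs v else 0)"
  by (induction xs) auto

lemma height_Suc_count: "height lam s = height lam (Suc s) + count_list lam s"
  by (induction lam) (auto simp: height_def)

text \<open>For \<open>e = 1 - \<epsilon>\<close>, a part contributes an odd number to the increments of \<open>wsum e lam\<close> iff
  it is congruent to \<open>\<epsilon>\<close>. So the parity of \<open>wsum\<close> can only be odd strictly inside a block of equal
  parts congruent to \<open>\<epsilon>\<close>.\<close>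

definition wsum :: "nat \<Rightarrow> nat list \<Rightarrow> nat \<Rightarrow> int" where
  "wsum e lam j = psum lam j + int (e * j)"

lemma wsum_0 [simp]: "wsum e lam 0 = 0"
  by (simp add: wsum_def)

lemma wsum_Suc: "wsum e lam (Suc j) = wsum e lam j + int (row lam j + e)"
  by (simp add: wsum_def psum_Suc)

lemma wsum_block:
  assumes "i \<le> j" "\<And>k. i \<le> k \<Longrightarrow> k < j \<Longrightarrow> row lam k = v"
  shows "wsum e lam j = wsum e lam i + int ((j - i) * (v + e))"
  using assms
proof (induction j rule: dec_induct)
  case (step j)
  then show ?case
    by (simp add: wsum_Suc Suc_diff_le algebra_simps)
qed simp

text \<open>By induction the value before an odd value is even, so the increment into the odd value
  is odd; equal rows make the increment out of it odd too.\<close>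

lemma wsum_alternates:
  assumes lin: "\<And>j. odd (wsum e lam (Suc j)) \<Longrightarrow> row lam j = row lam (Suc j)"
    and "odd (wsum e lam j)"
  shows "even (wsum e lam (Suc j))" "even (wsum e lam (j - 1))"
proof -
  have *: "even (wsum e lam (Suc j))" if "odd (wsum e lam j)" for j
    using that
  proof (induction j)
    case (Suc j)
    from lin[OF Suc.prems] have "row lam j = row lam (Suc j)" .
    with Suc show ?case
      unfolding wsum_Suc by auto
  qed simp
  show "even (wsum e lam (Suc j))"
    using * assms(2) by blast
  show "even (wsum e lam (j - 1))"
    using *[of "j - 1"] assms(2) by (cases j) auto
qed

lemma psum_height:
  assumes "is_partition N lam"
  shows "psum lam (height lam s) = int (sum_list (filter (\<lambda>x. s \<le> x) lam))"
  using assms by (simp add: psum_def sorted_filter_ge is_partition_def)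

lemma row_height:
  assumes "is_partition N lam" "0 < s"
  shows "row lam (height lam s) < s" "i < height lam s \<Longrightarrow> s \<le> row lam i"
  using less_height_iff[OF assms(1), of _ "s - 1"] assms(2)
  by (metis Suc_pred' less_irrefl not_less_eq not_less linorder_not_less) 
     (metis Suc_leI Suc_pred' assms(1) assms(2) less_height_iff)

lemma height_eqI:
  assumes "is_partition N lam" "row lam k < t" "\<And>i. k = Suc i \<Longrightarrow> t \<le> row lam i"
  shows "height lam t = k"
proof -
  have "k \<le> height lam t"
    using assms(2,3) less_height_iff[OF assms(1), of "k - 1" "t - 1"] by (cases k) auto
  moreover have "\<not> k < height lam t"
    using assms(2) less_height_iff[OF assms(1), of k "t - 1"] by auto
  ultimately show ?thesis by simp
qed

text \<open>The condition on the right says that the running sum is even at the end of every block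
  of equal parts. Its parity changes across a block precisely when a part congruent to \<epsilon>
  has odd multiplicity.\<close>

lemma nilpotent_partition_iff_wsum:
  assumes "\<epsilon> \<le> 1"
  shows "nilpotent_partition \<epsilon> N lam \<longleftrightarrow> is_partition N lam \<and>
    (\<forall>j. odd (wsum (1 - \<epsilon>) lam (Suc j)) \<longrightarrow> row lam j = row lam (Suc j))"
    (is "_ \<longleftrightarrow> _ \<and> ?lin")
proof (cases "is_partition N lam")
  case part: True
  let ?W = "wsum (1 - \<epsilon>) lam"
  have parity: "odd (s + (1 - \<epsilon>)) \<longleftrightarrow> s mod 2 = \<epsilon>" for s
    using assms by (cases \<epsilon>) (auto simp: mod2_eq_if)
  show ?thesis
  proof
    assume nilp: "nilpotent_partition \<epsilon> N lam"
    have "even (?W (Suc j))" if drop: "row lam j \<noteq> row lam (Suc j)" for j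
    proof -
      let ?s = "row lam j"
      have less: "row lam (Suc j) < ?s"
        using partition_row_antimono[OF part, of j "Suc j"] drop by simp
      then have s: "0 < ?s" by simp
      then have h: "height lam ?s = Suc j"
        using less by (intro height_eqI[OF part]) auto
      let ?xs = "filter (\<lambda>x. ?s \<le> x) lam"
      have "even (sum_list (map (\<lambda>x. x + (1 - \<epsilon>)) ?xs))"
      proof (rule even_sum_list_map)
        fix v assume "v \<in> set ?xs" "odd (v + (1 - \<epsilon>))"
        moreover from this have "v mod 2 = \<epsilon>"
          using parity by blast
        ultimately show "even (count_list ?xs v)"
          using nilp by (auto simp: nilpotent_partition_def count_list_filter)
      qed
      moreover have "sum_list (map (\<lambda>x. x + (1 - \<epsilon>)) ?xs) = sum_list ?xs + (1 - \<epsilon>) * Suc j"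
        unfolding h[symmetric] by (simp add: sum_list_addf height_def sum_list_triv)
      ultimately show ?thesis
        using psum_height[OF part, of ?s] h by (simp add: wsum_def)
    qed
    with part show "is_partition N lam \<and> ?lin"
      by blast
  next
    assume *: "is_partition N lam \<and> ?lin"
    \<comment> \<open>A height is either \<open>0\<close> or the position of a drop, where the
      hypothesis gives evenness.\<close>
    have evenW: "even (?W (height lam t))" if "0 < t" for t
    proof (cases "height lam t")
      case (Suc j)
      with row_height[OF part that] * show ?thesis
        by (metis lessI not_less)
    qed simp
    have "even (count_list lam s)" if s: "s \<in> set lam" "s mod 2 = \<epsilon>" for s
    proof -
      have "0 < s" using part s(1) by (auto simp: is_partition_def intro: gr0I)
      have "sum_list (filter (\<lambda>x. s \<le> x) xs) = sum_list (filter (\<lambda>x. Suc s \<le> x) xs) + s * count_list xs s"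
        for xs by (induction xs) auto
      then have "psum lam (height lam s) = psum lam (height lam (Suc s)) + int (s * count_list lam s)"
        unfolding psum_height[OF part] by (metis of_nat_add)
      moreover have "int ((1 - \<epsilon>) * height lam s)
          = int ((1 - \<epsilon>) * height lam (Suc s)) + int ((1 - \<epsilon>) * count_list lam s)"
        by (simp add: height_Suc_count[of lam s] algebra_simps)
      ultimately have "?W (height lam s)
          = ?W (height lam (Suc s)) + int (count_list lam s * (s + (1 - \<epsilon>)))"
        by (simp add: wsum_def algebra_simps)
      moreover have "odd (s + (1 - \<epsilon>))"
        using s parity by blast
      ultimately show ?thesis
        using evenW[of s] evenW[of "Suc s"] \<open>0 < s\<close> by (metis even_add even_mult_iff even_of_nat zero_less_Suc)
    qed
    with part show "nilpotent_partition \<epsilon> N lam"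
      by (simp add: nilpotent_partition_def)
  qed
qed (simp add: nilpotent_partition_def)

lemma eps_le_1: "eps X \<le> 1" "eps' X \<le> 1"
  by (cases X; simp)+

abbreviation W :: "lie_type \<Rightarrow> nat list \<Rightarrow> nat \<Rightarrow> int" where
  "W X \<equiv> wsum (1 - eps X)"

text \<open>Inside a block of parts congruent to \<epsilon> the parity of \<open>W\<close>
  alternates, it is even at both ends, and the block ends at the height of its part. So a height
  congruent to \<epsilon>' puts the odd values at positions of the other parity. The zeros after the
  last part form one more block, governed by the height condition at \<open>0\<close>.\<close>

lemma special_partition_iff_wsum:
  "special_partition X N lam \<longleftrightarrow> is_partition N lam \<and>
    (\<forall>j. odd (W X lam (Suc j)) \<longrightarrow> Suc j mod 2 \<noteq> eps' X \<and> row lam j = row lam (Suc j))"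
proof (cases "nilpotent_partition (eps X) N lam")
  case False
  then show ?thesis
    using eps_le_1 by (auto simp: special_partition_def nilpotent_partition_iff_wsum)
next
  case True
  let ?W = "W X lam"
  have part: "is_partition N lam"
    and lin: "\<And>j. odd (?W (Suc j)) \<Longrightarrow> row lam j = row lam (Suc j)"
    using True eps_le_1 by (auto simp: nilpotent_partition_iff_wsum)
  have parity: "odd (s + (1 - eps X)) \<longleftrightarrow> s mod 2 = eps X" for s
    using eps_le_1[of X] by (cases "eps X") (auto simp: mod2_eq_if)
  have evenW: "even (?W (height lam t))" for t
  proof (cases "0 < t \<and> 0 < height lam t")
    case True
    then obtain j where "height lam t = Suc j"
      using gr0_implies_Suc by blast
    with row_height[OF part, of t] True lin show ?thesis
      by (metis lessI not_less)
  next
    case False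
    have "even (?W (length lam))"
    proof (cases "length lam")
      case (Suc j)
      then have "row lam j \<noteq> row lam (Suc j)"
        using partition_row_pos[OF part, of j] partition_row_pos[OF part, of "Suc j"] by simp
      with lin Suc show ?thesis by metis
    qed simp
    moreover have "height lam 0 = length lam"
      by (simp add: height_def)
    ultimately show ?thesis
      using False by (cases "t = 0") auto
  qed
  have len: "height lam 0 = length lam"
    by (simp add: height_def)
  show ?thesis
  proof
    assume sp: "special_partition X N lam"
    have "Suc j mod 2 \<noteq> eps' X" if "odd (?W (Suc j))" for j
    proof -
      define v where "v = row lam (Suc j)"
      have v: "row lam j = v"
        using lin[OF that] by (simp add: v_def)
      have "odd (v + (1 - eps X))"
        using wsum_alternates(1)[OF lin that] that wsum_Suc[of "1 - eps X" lam "Suc j"]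
        by (auto simp: v_def)
      then have mod_v: "v mod 2 = eps X"
        using parity by blast
      let ?h = "height lam v"
      \<comment> \<open>\<open>max\<close> and \<open>min\<close> cover both cases: for
        \<open>v = 0\<close> the height is the start of the block of zeros and lies before
        \<open>Suc j\<close>, otherwise it is the end of the block and lies after it.\<close>
      have "odd (max ?h (Suc j) - min ?h (Suc j)) \<and> ?h mod 2 = eps' X"
      proof (cases "v = 0")
        case True
        then have "length lam \<le> j"
          using v partition_row_pos[OF part, of j] by simp
        moreover have "?W (Suc j) = ?W (length lam) + int ((Suc j - length lam) * (0 + (1 - eps X)))"
          using calculation by (intro wsum_block) (auto simp: nth_default_def)
        ultimately have "odd (Suc j - length lam)"
          using that evenW[of 0] len by auto
        then show ?thesis
          using True mod_v sp \<open>length lam \<le> j\<close>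
          by (auto simp: special_partition_def len max_def min_def)
      next
        case False
        have "Suc j < ?h"
          using less_height_iff[OF part, of "Suc j" "v - 1"] False by (simp add: v_def)
        moreover have "?W ?h = ?W (Suc j) + int ((?h - Suc j) * (v + (1 - eps X)))"
        proof (rule wsum_block)
          fix k assume k: "Suc j \<le> k" "k < ?h"
          with partition_row_antimono[OF part k(1)] row_height(2)[OF part, of v k] False
          show "row lam k = v" by (simp add: v_def)
        qed (use calculation in simp)
        ultimately have "odd (?h - Suc j)"
          using that evenW[of v] by auto
        moreover have "v \<in> set lam"
          using False by (auto simp: v_def nth_default_def split: if_splits)
        ultimately show ?thesis
          using mod_v sp \<open>Suc j < ?h\<close> by (auto simp: special_partition_def max_def min_def)
      qed
      then show ?thesis
        by (auto simp: max_def min_def split: if_splits)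
    qed
    with part lin show "is_partition N lam \<and>
        (\<forall>j. odd (?W (Suc j)) \<longrightarrow> Suc j mod 2 \<noteq> eps' X \<and> row lam j = row lam (Suc j))"
      by blast
  next
    assume *: "is_partition N lam \<and>
        (\<forall>j. odd (?W (Suc j)) \<longrightarrow> Suc j mod 2 \<noteq> eps' X \<and> row lam j = row lam (Suc j))"
    have neq: "j mod 2 \<noteq> eps' X" if "odd (?W j)" for j
      using * that by (cases j) auto
    have "height lam s mod 2 = eps' X" if s: "s \<in> insert 0 (set lam)" "s mod 2 = eps X" for s
    proof (cases "s = 0")
      case True
      have "?W (Suc (length lam)) = ?W (length lam) + int (0 + (1 - eps X))"
        unfolding wsum_Suc by (simp add: nth_default_def)
      then have "odd (?W (Suc (length lam)))"
        using evenW[of 0] True s len by simp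
      from neq[OF this] show ?thesis
        using True len eps_le_1[of X] by (simp; presburger)
    next
      case False
      have "0 < count_list lam s"
        using s False by (metis count_list_0_iff gr0I insertE)
      then obtain h where h: "height lam s = Suc h" "height lam (Suc s) \<le> h"
        using height_Suc_count[of lam s] gr0_implies_Suc[of "height lam s"] by fastforce
      have "row lam h = s"
        using row_height(2)[OF part, of s h] False h less_height_iff[OF part, of h s] by auto
      \<comment> \<open>\<open>h\<close> is the last row of the block, so the even value at the end
        of the block is preceded by an odd one.\<close>
      then have "odd (?W h)"
        using evenW[of s] h(1) wsum_Suc[of "1 - eps X" lam h] parity[of s] s(2) by auto
      from neq[OF this] show ?thesis
        using h(1) eps_le_1[of X] by (simp; presburger)
    qed
    moreover have "N mod 2 = size_parity X"
    proof -
      \<comment> \<open>A position beyond the last part and congruent to \<epsilon>';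
        \<open>W\<close> is even there, which yields the parity of \<open>N\<close>.\<close>
      let ?j = "2 * length lam + eps' X"
      have "even (?W ?j)"
        using neq[of ?j] eps_le_1[of X] by auto
      moreover have "?W ?j = int N + int ((1 - eps X) * ?j)"
        by (simp add: wsum_def psum_eventually partition_sum[OF part])
      ultimately have "even (int N + int ((1 - eps X) * ?j))"
        by simp
      then show ?thesis
        by (cases X) (auto simp: mod2_eq_if)
    qed
    ultimately show "special_partition X N lam"
      using True by (simp add: special_partition_def)
  qed
qed

lemma special_is_partition: "special_partition X N lam \<Longrightarrow> is_partition N lam"
  by (simp add: special_partition_def nilpotent_partition_def)

lemma eps_d_type: "eps (d_type X) = 1 - eps' X" "eps' (d_type X) = 1 - eps X"
  by (cases X; simp)+

text \<open>Equivalently: the corners \<open>(h, s)\<close> of the boundary path of the Young diagram, convex or concave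
  and including the two endpoints on the axes, satisfy that \<open>s\<close> congruent to \<open>\<epsilon>\<close> implies \<open>h\<close>
  congruent to \<open>\<epsilon>'\<close>. Contraposition turns this into the condition for the conjugate.\<close>

lemma special_conjugate:
  assumes "special_partition X N lam"
  shows "special_partition (d_type X) N (conjugate lam)"
proof -
  have part: "is_partition N lam"
    using assms by (rule special_is_partition)
  note cpart = conjugate_partition[OF part]
  have nz: "0 \<notin> set lam"
    using part by (simp add: is_partition_def)
  have above: "height lam s mod 2 = eps' X" if "s = 0 \<or> s \<in> set lam" "s mod 2 = eps X" for s
    using assms that by (auto simp: special_partition_def)
  \<comment> \<open>Even multiplicity carries the height condition from one end of the block to the
    other.\<close>
  have below: "height lam (Suc s) mod 2 = eps' X" if "s \<in> set lam" "s mod 2 = eps X" for s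
  proof -
    have "even (count_list lam s)"
      using assms that by (auto simp: special_partition_def nilpotent_partition_def)
    with above[of s] that height_Suc_count[of lam s] show ?thesis
      by (simp add: mod2_eq_if split: if_splits)
  qed
  have mem: "row lam k = 0 \<or> row lam k \<in> set lam" for k
    by (simp add: nth_default_def)
  have flip: "a mod 2 = 1 - e" if "a mod 2 \<noteq> e" "e \<le> 1" for a e :: nat
    using that by (cases e) auto
  have height_c: "height (conjugate lam) (Suc k) = row lam k" for k
    using row_conjugate[OF cpart, of k] conjugate_conjugate[OF part] by simp
  \<comment> \<open>Contraposition at the corner where row \<open>k\<close> begins a block;
    \<open>k = 0\<close> and \<open>row lam k = 0\<close> give the corners on the axes.\<close>
  have inner: "row lam k mod 2 = 1 - eps X"
    if "k mod 2 = 1 - eps' X" and drop: "\<And>i. k = Suc i \<Longrightarrow> row lam k < row lam i" for k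
  proof (rule flip[OF _ eps_le_1(1)], rule)
    assume eq: "row lam k mod 2 = eps X"
    have "height lam (if row lam k = 0 then 0 else Suc (row lam k)) = k"
    proof (cases "row lam k = 0")
      case True
      then have "length lam = k"
        using drop partition_row_pos[OF part, of k] partition_row_pos[OF part, of "k - 1"]
        by (cases k) auto
      with True show ?thesis by (simp add: height_def)
    next
      case False
      then show ?thesis
        using drop by (auto intro!: height_eqI[OF part])
    qed
    then have "k mod 2 = eps' X"
      using above[of 0] below[of "row lam k"] mem[of k] eq by (auto split: if_splits)
    with that(1) eps_le_1(2)[of X] show False
      by (cases "eps' X") auto
  qed
  \<comment> \<open>The same at the corner below row \<open>k\<close> when this row ends a
    block.\<close>
  have outer: "row lam k mod 2 = 1 - eps X"
    if "Suc k mod 2 = 1 - eps' X" and drop: "row lam (Suc k) < row lam k" for k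
  proof (rule flip[OF _ eps_le_1(1)], rule)
    assume eq: "row lam k mod 2 = eps X"
    have "height lam (row lam k) = Suc k"
      using drop by (intro height_eqI[OF part]) auto
    then have "Suc k mod 2 = eps' X"
      using above[of "row lam k"] mem[of k] eq by auto
    with that(1) eps_le_1(2)[of X] show False
      by (cases "eps' X") auto
  qed
  have drop: "\<exists>m. k = Suc m \<and> row lam k < row lam m" if kin: "k \<in> set (conjugate lam)" for k
  proof -
    obtain i where i: "i < length (conjugate lam)" "conjugate lam ! i = k"
      using kin by (auto simp: in_set_conv_nth)
    then have k: "k = height lam (Suc i)"
      using row_conjugate[OF part, of i] by (simp add: nth_default_nth)
    have "0 < k"
      using partition_row_pos[OF cpart, of i] i by (simp add: nth_default_nth)
    then obtain m where m: "k = Suc m"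
      using gr0_implies_Suc by blast
    have "row lam k < Suc i" "Suc i \<le> row lam m"
      using row_height[OF part, of "Suc i"] k m by auto
    with m show ?thesis by auto
  qed
  have "even (count_list (conjugate lam) k)"
    if k: "k \<in> set (conjugate lam)" "k mod 2 = 1 - eps' X" for k
  proof -
    obtain m where m: "k = Suc m" "row lam k < row lam m"
      using drop[OF k(1)] by blast
    \<comment> \<open>The multiplicity of \<open>k\<close> in the conjugate is the drop from row
      \<open>m\<close> to row \<open>k\<close>; both ends of this drop are corners at height
      \<open>k\<close>.\<close>
    have "row lam m mod 2 = row lam k mod 2"
      using outer[of m] inner[of k] m k by (metis old.nat.inject)
    moreover have "row lam m = row lam k + count_list (conjugate lam) k"
      using height_Suc_count[of "conjugate lam" k] by (simp add: m(1) height_c)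
    ultimately show ?thesis
      by presburger
  qed
  moreover have "height (conjugate lam) k mod 2 = 1 - eps X"
    if k: "k \<in> insert 0 (set (conjugate lam))" "k mod 2 = 1 - eps' X" for k
  proof (cases "k = 0")
    case True
    have "length (conjugate lam) = row lam 0"
      by (cases lam) (simp_all add: conjugate_def largest_part_def)
    moreover have "row lam 0 mod 2 = 1 - eps X"
      using k(2) True by (intro inner) auto
    ultimately show ?thesis
      using True by (simp add: height_def)
  next
    case False
    with k obtain m where "k = Suc m" "row lam k < row lam m"
      using drop by blast
    with k(2) have "row lam m mod 2 = 1 - eps X"
      by (intro outer) auto
    with \<open>k = Suc m\<close> show ?thesis
      by (simp only: height_c)
  qed
  moreover have "size_parity (d_type X) = size_parity X"
    by (cases X) simp_all
  ultimately show ?thesis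
    using assms cpart by (auto simp: special_partition_def nilpotent_partition_def eps_d_type)
qed

section \<open>Halved partial sums\<close>

fun unit_B :: "lie_type \<Rightarrow> int" where
  "unit_B Type_B = 1" | "unit_B _ = 0"

fun unit_D :: "lie_type \<Rightarrow> int" where
  "unit_D Type_D = 1" | "unit_D _ = 0"

text \<open>\<open>unit_D\<close> makes the rounding upwards in type \<open>D\<close>; with this
  choice \<open>f\<close> preserves the sequence.\<close>

definition halfsum :: "lie_type \<Rightarrow> nat list \<Rightarrow> nat \<Rightarrow> int" where
  "halfsum X lam j = (psum lam j + unit_D X) div 2"

text \<open>The value at \<open>0\<close> is a dummy, chosen nonzero so that it never counts as a zero defect.\<close>

definition defect :: "lie_type \<Rightarrow> (nat \<Rightarrow> int) \<Rightarrow> nat \<Rightarrow> int" where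
  "defect X T j = (if j = 0 then 1 else
     2 * T j - T (j - 1) - T (Suc j) + (if j mod 2 = eps' X then 1 - int (eps X) else int (eps X)))"

text \<open>The sequences are infinite and stabilise, so no number of parts is fixed;
  \<open>n\<close> corresponds to the size \<open>2 * n + unit_B X\<close>.\<close>

definition admissible :: "lie_type \<Rightarrow> nat \<Rightarrow> (nat \<Rightarrow> int) \<Rightarrow> bool" where
  "admissible X n T \<longleftrightarrow> T 0 = 0 \<and> (\<forall>j. 0 \<le> defect X T j) \<and>
     (\<forall>j. defect X T j \<noteq> 0 \<or> defect X T (Suc j) \<noteq> 0) \<and> (\<exists>M. \<forall>j\<ge>M. T j = int n)"

text \<open>Recovers the partial sums of a special partition from the halved ones.\<close>

definition expand :: "lie_type \<Rightarrow> (nat \<Rightarrow> int) \<Rightarrow> nat \<Rightarrow> int" where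
  "expand X T j = 2 * T j + unit_B X +
     (if j mod 2 = eps' X then 0 else of_bool (defect X T j = 0) - (1 - int (eps X)))"

lemma eps_f_type: "eps (f_type X) = 1 - eps X" "eps' (f_type X) = 1 - eps' X"
  by (cases X; simp)+

text \<open>Flipping both parities interchanges the two branches of the correction term and also
  their values, so every \<open>j\<close> keeps its correction.\<close>

lemma defect_f_type [simp]: "defect (f_type X) T = defect X T"
  by (rule ext, cases X) (simp_all add: defect_def mod2_eq_if)

lemma admissible_f_type [simp]: "admissible (f_type X) = admissible X"
  by (intro ext) (simp add: admissible_def)

text \<open>Call \<open>j\<close> outer if \<open>j mod 2 = eps' X\<close> and inner otherwise. The
  left side is the drop between consecutive rows once \<open>expand X T\<close> gives the partial
  sums. The right side is nonnegative if the defects are nonnegative without two adjacent zeros; the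
  shapes of degenerations are read off from it later.\<close>

lemma expand_second_difference:
  "2 * expand X T (Suc j) - expand X T j - expand X T (Suc (Suc j)) =
    (if Suc j mod 2 = eps' X
     then 2 * defect X T (Suc j) - of_bool (defect X T j = 0) - of_bool (defect X T (Suc (Suc j)) = 0)
     else 2 * (defect X T (Suc j) - 1 + of_bool (defect X T (Suc j) = 0)))"
proof (cases "Suc j mod 2 = eps' X")
  case True
  then have "j mod 2 \<noteq> eps' X" "Suc (Suc j) mod 2 \<noteq> eps' X"
    by presburger+
  moreover have "defect X T (Suc j) = 2 * T (Suc j) - T j - T (Suc (Suc j)) + 1 - int (eps X)"
    using True by (simp add: defect_def)
  ultimately show ?thesis
    using True by (simp add: expand_def)
next
  case False
  then have "j mod 2 = eps' X" "Suc (Suc j) mod 2 = eps' X"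
    using eps_le_1[of X] by presburger+
  moreover have "defect X T (Suc j) = 2 * T (Suc j) - T j - T (Suc (Suc j)) + int (eps X)"
    using False by (simp add: defect_def)
  ultimately show ?thesis
    using False by (simp add: expand_def)
qed

section \<open>Special partitions as admissible sequences\<close>

lemma even_W_iff: "even (W X lam j) \<longleftrightarrow> (odd (psum lam j) \<longleftrightarrow> eps X = 0 \<and> odd j)"
  by (cases X) (simp_all add: wsum_def)

lemma psum_boundary:
  assumes "j mod 2 = eps' X" "even (W X lam j)"
  shows "psum lam j = 2 * halfsum X lam j + unit_B X"
  using assms unfolding even_W_iff halfsum_def
  by (cases X; cases "even j"; cases "even (psum lam j)"; simp add: mod2_eq_if; presburger?)

lemma psum_inner:
  assumes "j mod 2 \<noteq> eps' X"
  shows "psum lam j = 2 * halfsum X lam j + unit_B X + (of_bool (odd (W X lam j)) - (1 - int (eps X)))"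
  using assms unfolding even_W_iff halfsum_def
  by (cases X; cases "even j"; cases "even (psum lam j)"; simp add: mod2_eq_if; presburger?)

text \<open>The second difference formula holds with odd \<open>W\<close> in place of inner zero
  defects. Equal rows at odd \<open>W\<close> and concavity elsewhere show that the two agree;
  concavity then also gives the conditions on the defects.\<close>

lemma
  assumes sp: "special_partition X N lam"
  shows special_admissible: "\<exists>n. int N = 2 * int n + unit_B X \<and> admissible X n (halfsum X lam)"
    and psum_eq_expand: "psum lam = expand X (halfsum X lam)"
proof -
  let ?T = "halfsum X lam" and ?S = "psum lam"
  have part: "is_partition N lam"
    and char: "\<And>j. odd (W X lam (Suc j)) \<Longrightarrow> Suc j mod 2 \<noteq> eps' X \<and> row lam j = row lam (Suc j)"
    using sp by (auto simp: special_partition_iff_wsum)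
  have bd: "even (W X lam j)" if "j mod 2 = eps' X" for j
    using char that by (cases j) auto
  have S: "?S j = 2 * ?T j + unit_B X +
      (if j mod 2 = eps' X then 0 else of_bool (odd (W X lam j)) - (1 - int (eps X)))" for j
    using psum_boundary[of j X lam] psum_inner[of j X lam] bd[of j] by auto
  have second: "2 * ?S (Suc j) - ?S j - ?S (Suc (Suc j)) =
    (if Suc j mod 2 = eps' X
     then 2 * defect X ?T (Suc j) - of_bool (odd (W X lam j)) - of_bool (odd (W X lam (Suc (Suc j))))
     else 2 * (defect X ?T (Suc j) - 1 + of_bool (odd (W X lam (Suc j)))))" for j
  proof (cases "Suc j mod 2 = eps' X")
    case True
    then have "j mod 2 \<noteq> eps' X" "Suc (Suc j) mod 2 \<noteq> eps' X"
      by presburger+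
    moreover have "defect X ?T (Suc j) = 2 * ?T (Suc j) - ?T j - ?T (Suc (Suc j)) + 1 - int (eps X)"
      using True by (simp add: defect_def)
    ultimately show ?thesis
      using True by (simp add: S)
  next
    case False
    then have "j mod 2 = eps' X" "Suc (Suc j) mod 2 = eps' X"
      using eps_le_1[of X] by presburger+
    moreover have "defect X ?T (Suc j) = 2 * ?T (Suc j) - ?T j - ?T (Suc (Suc j)) + int (eps X)"
      using False by (simp add: defect_def)
    ultimately show ?thesis
      using False by (simp add: S)
  qed
  have conc: "0 \<le> 2 * ?S (Suc j) - ?S j - ?S (Suc (Suc j))" for j
    using psum_concave[OF part, of j] by simp
  have lin: "2 * ?S (Suc j) - ?S j - ?S (Suc (Suc j)) = 0" if "odd (W X lam (Suc j))" for j
    using char[OF that] by (simp add: psum_Suc)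
  \<comment> \<open>At an inner position odd \<open>W\<close> makes the drop equal to
    \<open>2 * defect\<close>, and this drop vanishes; even \<open>W\<close> makes it
    \<open>2 * (defect - 1)\<close>, which is not negative.\<close>
  have odd_iff: "odd (W X lam j) \<longleftrightarrow> j mod 2 \<noteq> eps' X \<and> defect X ?T j = 0" for j
  proof (cases j)
    case (Suc i)
    show ?thesis
    proof (cases "odd (W X lam j)")
      case True
      with lin[of i] second[of i] char[of i] Suc show ?thesis by auto
    next
      case False
      with conc[of i] second[of i] Suc show ?thesis by auto
    qed
  qed (simp add: defect_def)
  show "?S = expand X ?T"
    by (rule ext) (simp only: S expand_def odd_iff, simp)
  have nonneg: "0 \<le> defect X ?T j" for j
  proof (cases j)
    case (Suc i)
    then show ?thesis
      using conc[of i] second[of i] odd_iff[of j] by (auto simp: of_bool_def split: if_splits)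
  qed (simp add: defect_def)
  \<comment> \<open>One of two adjacent positions is outer; if both defects vanished, the drop there
    would be negative.\<close>
  have no_two: "defect X ?T j \<noteq> 0 \<or> defect X ?T (Suc j) \<noteq> 0" for j
  proof (rule ccontr)
    assume *: "\<not> ?thesis"
    then obtain i where i: "j = Suc i" by (cases j) (auto simp: defect_def)
    show False
    proof (cases "j mod 2 = eps' X")
      case True
      then have "Suc j mod 2 \<noteq> eps' X" by presburger
      with True * conc[of i] second[of i] odd_iff[of "Suc j"] i show False
          by (auto simp: of_bool_def split: if_splits)
    next
      case False
      then have "Suc j mod 2 = eps' X" using eps_le_1[of X] by presburger
      with False * conc[of j] second[of j] odd_iff[of j] show False
          by (auto simp: of_bool_def split: if_splits)
    qed
  qed
  define n where "n = nat ((int N + unit_D X) div 2)"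
  have n: "int n = (int N + unit_D X) div 2"
    by (cases X) (simp_all add: n_def)
  have "?T j = int n" if "length lam \<le> j" for j
    using that by (simp add: halfsum_def psum_eventually n partition_sum[OF part])
  moreover have "?T 0 = 0"
    by (cases X) (simp_all add: halfsum_def)
  moreover have "N mod 2 = size_parity X"
    using sp by (simp add: special_partition_def)
  then have "int N = 2 * int n + unit_B X"
    unfolding n by (cases X) (simp_all; presburger)+
  ultimately show "\<exists>n. int N = 2 * int n + unit_B X \<and> admissible X n ?T"
    using nonneg no_two unfolding admissible_def by blast
qed

lemma admissible_realize:
  assumes adm: "admissible X n T" and N: "int N = 2 * int n + unit_B X"
  obtains lam where "special_partition X N lam" "halfsum X lam = T"
proof -
  let ?S = "expand X T"
  have nonneg: "\<And>j. 0 \<le> defect X T j" and T0: "T 0 = 0"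
    and no_two: "\<And>j. defect X T j \<noteq> 0 \<or> defect X T (Suc j) \<noteq> 0"
    using adm by (auto simp: admissible_def)
  obtain M where M: "\<And>j. M \<le> j \<Longrightarrow> T j = int n"
    using adm by (auto simp: admissible_def)
  have conc: "?S j + ?S (Suc (Suc j)) \<le> 2 * ?S (Suc j)" for j
  proof -
    have "0 \<le> 2 * ?S (Suc j) - ?S j - ?S (Suc (Suc j))"
      using nonneg[of "Suc j"] no_two[of j] no_two[of "Suc j"]
      unfolding expand_second_difference by (auto split: if_splits)
    then show ?thesis by simp
  qed
  obtain lam where lam: "is_partition N lam" "psum lam = ?S"
  proof (rule partition_of_psum[where S = ?S and M = "Suc M" and N = N, OF _ conc])
    show "?S 0 = 0"
      by (cases X) (simp_all add: expand_def defect_def T0)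
    \<comment> \<open>The defect at \<open>j\<close> involves \<open>T (j - 1)\<close>, so stability
      starts one step later. There the defect is just its correction term, and the two inner terms
      of \<open>expand\<close> cancel.\<close>
    fix j assume "Suc M \<le> j"
    then have "M \<le> j" "M \<le> j - 1" "M \<le> Suc j" "j \<noteq> 0" by auto
    then show "?S j = int N"
      using M by (cases X) (auto simp: expand_def defect_def N mod2_eq_if)
  qed
  have W: "odd (W X lam j) \<longleftrightarrow> j mod 2 \<noteq> eps' X \<and> defect X T j = 0" for j
    unfolding even_W_iff lam(2) expand_def
    by (cases X; cases "even j") (auto simp: mod2_eq_if)
  have "special_partition X N lam"
    unfolding special_partition_iff_wsum
  proof (intro conjI lam(1) allI impI)
    fix j assume odd: "odd (W X lam (Suc j))"
    with W show "Suc j mod 2 \<noteq> eps' X" by blast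
    with odd W[of "Suc j"] expand_second_difference[of X T j]
    have "2 * ?S (Suc j) - ?S j - ?S (Suc (Suc j)) = 0"
      by simp
    then show "row lam j = row lam (Suc j)"
      unfolding lam(2)[symmetric] by (simp add: psum_Suc)
  qed
  moreover have "halfsum X lam = T"
    by (rule ext, cases X) (auto simp: halfsum_def lam(2) expand_def)
  ultimately show ?thesis
    using that by blast
qed

text \<open>Rounding is monotone. Conversely, partial sums at outer positions are affine in the
  halved ones. At an inner position with zero defect \<open>lam\<close> is straight, and concavity
  of \<open>mu\<close> extends the comparison from the two neighbours; with nonzero defect
  \<open>lam\<close> takes the smaller of its two possible values.\<close>

lemma psum_le_iff_halfsum_le:
  assumes lam: "special_partition X N lam" and mu: "special_partition X N' mu"
  shows "(\<forall>j. psum lam j \<le> psum mu j) \<longleftrightarrow> (\<forall>j. halfsum X lam j \<le> halfsum X mu j)"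
proof
  assume "\<forall>j. psum lam j \<le> psum mu j"
  then show "\<forall>j. halfsum X lam j \<le> halfsum X mu j"
    unfolding halfsum_def by (auto intro!: zdiv_mono1)
next
  assume le: "\<forall>j. halfsum X lam j \<le> halfsum X mu j"
  note S = psum_eq_expand[OF lam] psum_eq_expand[OF mu]
  have bd: "psum lam j \<le> psum mu j" if "j mod 2 = eps' X" for j
    using that le by (simp add: S expand_def)
  show "\<forall>j. psum lam j \<le> psum mu j"
  proof
    fix j
    show "psum lam j \<le> psum mu j"
    proof (cases "j mod 2 = eps' X \<or> j = 0")
      case False
      then obtain i where i: "j = Suc i" by (cases j) auto
      have nb: "i mod 2 = eps' X" "Suc (Suc i) mod 2 = eps' X"
        using False eps_le_1[of X] i by presburger+
      show ?thesis
      proof (cases "defect X (halfsum X lam) j = 0")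
        case True
        then have "2 * psum lam j = psum lam i + psum lam (Suc (Suc i))"
          using expand_second_difference[of X "halfsum X lam" i] False i by (simp add: S)
        also have "\<dots> \<le> psum mu i + psum mu (Suc (Suc i))"
          using bd nb by (intro add_mono) auto
        also have "\<dots> \<le> 2 * psum mu j"
          using psum_concave[OF special_is_partition[OF mu]] i by blast
        finally show ?thesis by simp
      next
        case nonlin: False
        show ?thesis
          using le[rule_format, of j] nonlin by (simp add: S expand_def)
      qed
    qed (use bd in auto)
  qed
qed

lemma special_eqI:
  assumes "special_partition X N lam" "special_partition X N' mu" "halfsum X lam = halfsum X mu"
  shows "lam = mu"
  using assms psum_eq_expand[OF assms(1)] psum_eq_expand[OF assms(2)]
  by (intro partition_eqI_psum[of N lam N' mu] special_is_partition) auto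

section \<open>The maps on special partitions\<close>

lemma nilpotent_partition_is_partition: "nilpotent_partition \<epsilon> N lam \<Longrightarrow> is_partition N lam"
  by (simp add: nilpotent_partition_def)

lemma special_nilpotent: "special_partition X N lam \<Longrightarrow> nilpotent_partition (eps X) N lam"
  by (simp add: special_partition_def)

section \<open>Collapses and the map \<open>f\<close>\<close>

lemma collapse_eqI:
  assumes "sum_list kap = N" "nilpotent_partition (eps Y) N nu"
    and "\<And>j. psum nu j \<le> psum kap j"
    and max: "\<And>xi. nilpotent_partition (eps Y) N xi \<Longrightarrow> (\<And>j. psum xi j \<le> psum kap j) \<Longrightarrow>
      (\<And>j. psum xi j \<le> psum nu j)"
  shows "collapse Y kap = nu"
  unfolding collapse_def
proof (rule the_equality)
  show *: "nilpotent_partition (eps Y) (sum_list kap) nu \<and> nu \<unlhd> kap \<and>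
      (\<forall>xi. nilpotent_partition (eps Y) (sum_list kap) xi \<and> xi \<unlhd> kap \<longrightarrow> xi \<unlhd> nu)"
    using assms by (auto simp: dominated_iff_psum partition_sum[OF nilpotent_partition_is_partition])
  fix xi
  assume **: "nilpotent_partition (eps Y) (sum_list kap) xi \<and> xi \<unlhd> kap \<and>
      (\<forall>x. nilpotent_partition (eps Y) (sum_list kap) x \<and> x \<unlhd> kap \<longrightarrow> x \<unlhd> xi)"
  with * have "xi \<unlhd> nu" "nu \<unlhd> xi"
    by blast+
  then have "psum xi j = psum nu j" for j
    by (simp add: dominated_iff_psum eq_iff)
  with * ** show "xi = nu"
    using partition_eqI_psum nilpotent_partition_is_partition by blast
qed

text \<open>Lets the \<open>C\<close>-collapse in the definition of \<open>f\<close> on type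
  \<open>D\<close> count as a collapse into type \<open>C'\<close>.\<close>

lemma collapse_cong: "eps Y = eps Z \<Longrightarrow> collapse Y = collapse Z"
  by (rule ext) (simp add: collapse_def)

lemma sum_list_raise_first: "sum_list (raise_first xs) = Suc (sum_list xs)"
  by (cases xs) simp_all

lemma psum_raise_first: "psum (raise_first xs) j = psum xs j + of_bool (0 < j)"
  by (cases xs; cases j) (simp_all add: psum_def)

lemma zero_notin_raise_first: "0 \<notin> set xs \<Longrightarrow> 0 \<notin> set (raise_first xs)"
  by (cases xs) simp_all

lemma psum_append: "psum (xs @ ys) j = psum xs j + psum ys (j - length xs)"
  by (simp add: psum_def)

lemma lower_last_snoc: "lower_last (xs @ [y]) = (if y = 1 then xs else xs @ [y - 1])"
  by (simp add: lower_last_def)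

text \<open>All parts are positive, so only the partial sums equal to the total change.\<close>

lemma psum_lower_last:
  assumes "0 \<notin> set xs" "xs \<noteq> []"
  shows "psum (lower_last xs) j = min (psum xs j) (int (sum_list xs) - 1)"
proof -
  obtain ys y where xs: "xs = ys @ [y]"
    using assms(2) by (metis append_butlast_last_id)
  have y: "0 < y"
    using assms(1) by (auto simp: xs)
  have single: "psum [z] k = (if k = 0 then 0 else int z)" for z k
    by (cases k) (simp_all add: psum_def)
  have "psum ys j \<le> int (sum_list ys)"
    by (rule psum_le_total)
  moreover have "psum ys j = int (sum_list ys)" if "\<not> j \<le> length ys"
    using that by (simp add: psum_eventually)
  ultimately show ?thesis
    using y by (auto simp: xs lower_last_snoc psum_append single)
qed

lemma sum_list_lower_last:
  assumes "0 \<notin> set xs"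
  shows "sum_list (lower_last xs) = sum_list xs - 1"
proof (cases xs rule: rev_cases)
  case (snoc ys y)
  with assms have "0 < y" by auto
  with snoc show ?thesis by (simp add: lower_last_snoc)
qed (simp add: lower_last_def)

text \<open>The argument of the collapse in \<open>f_map\<close>, isolated so that the four cases of
  \<open>f\<close> can be treated together.\<close>

fun pre_collapse :: "lie_type \<Rightarrow> nat list \<Rightarrow> nat list" where
  "pre_collapse Type_B lam = lower_last lam"
| "pre_collapse Type_C lam = raise_first lam"
| "pre_collapse Type_D lam = lower_last (raise_first lam)"
| "pre_collapse Type_C' lam = lam"

lemma f_map_pre_collapse: "f_map X lam = collapse (f_type X) (pre_collapse X lam)"
  by (cases X) (simp_all add: collapse_cong[of Type_C Type_C'])

lemma pre_collapse_sum:
  assumes "special_partition X N lam"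
  shows "int (sum_list (pre_collapse X lam)) = int N - unit_B X + unit_B (f_type X)"
proof -
  have part: "is_partition N lam" and N: "N mod 2 = size_parity X"
    using assms by (auto simp: special_partition_def nilpotent_partition_def)
  then have nz: "0 \<notin> set lam" and sum: "sum_list lam = N"
    by (auto simp: is_partition_def)
  show ?thesis
    using N nz zero_notin_raise_first[OF nz]
    by (cases X) (auto simp: sum sum_list_raise_first sum_list_lower_last of_nat_diff)
qed

lemma psum_pre_collapse_odd:
  assumes "special_partition X N lam" "eps X = 1"
  shows "psum (pre_collapse X lam) j = psum lam j + of_bool (0 < j) * unit_B (f_type X)"
  using assms(2) by (cases X) (simp_all add: psum_raise_first)

lemma psum_pre_collapse_even:
  assumes "special_partition X N lam" "eps X = 0"
  shows "psum (pre_collapse X lam) j = min (psum lam j + of_bool (0 < j) * unit_D X) (int N - unit_B X)"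
proof -
  have part: "is_partition N lam" and N: "N mod 2 = size_parity X"
    using assms(1) by (auto simp: special_partition_def nilpotent_partition_def)
  then have nz: "0 \<notin> set lam" and sum: "sum_list lam = N"
    by (auto simp: is_partition_def)
  show ?thesis
  proof (cases X)
    case Type_B
    with N sum have "lam \<noteq> []" by auto
    with Type_B show ?thesis
      by (simp add: psum_lower_last[OF nz] sum)
  next
    case Type_D
    moreover have "raise_first lam \<noteq> []" by (cases lam) simp_all
    ultimately show ?thesis
      by (simp add: psum_lower_last[OF zero_notin_raise_first[OF nz]] psum_raise_first
          sum_list_raise_first sum)
  qed (use assms(2) in simp_all)
qed

text \<open>The formulas for \<open>lam\<close> and \<open>nu\<close> in the common halved sums
  place \<open>nu\<close> below the uncollapsed partition. A competitor \<open>xi\<close> exceeding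
  \<open>nu\<close> at some position has odd \<open>W\<close> there, so it is straight there with
  even \<open>W\<close> at both neighbours. Bounds at the neighbours contradict concavity of
  \<open>nu\<close> or straightness of \<open>lam\<close>.\<close>

lemma f_map_eqI:
  assumes lam: "special_partition X N lam" and nu: "special_partition (f_type X) N' nu"
    and T: "halfsum (f_type X) nu = halfsum X lam" and N': "int N' = int N - unit_B X + unit_B (f_type X)"
  shows "f_map X lam = nu"
  unfolding f_map_pre_collapse
proof (rule collapse_eqI)
  let ?T = "halfsum X lam" and ?c = "unit_B (f_type X)"
  let ?lin = "\<lambda>j. of_bool (defect X ?T j = 0) :: int"
  show "sum_list (pre_collapse X lam) = N'"
    using pre_collapse_sum[OF lam] N' by simp
  show "nilpotent_partition (eps (f_type X)) N' nu"
    by (rule special_nilpotent[OF nu])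
  have part_nu: "is_partition N' nu"
    by (rule special_is_partition[OF nu])
  have T0: "?T 0 = 0"
    by (cases X) (simp_all add: halfsum_def)
  have bd: "j mod 2 = eps' X \<longleftrightarrow> j mod 2 \<noteq> eps' (f_type X)" for j
    by (cases X) auto
  have lam_eq: "psum lam j = 2 * ?T j + unit_B X +
      (if j mod 2 = eps' (f_type X) then ?lin j - (1 - int (eps X)) else 0)" for j
    using bd[of j] by (subst psum_eq_expand[OF lam]) (simp add: expand_def)
  have nu_eq: "psum nu j = 2 * ?T j + ?c +
      (if j mod 2 = eps' (f_type X) then 0 else ?lin j - int (eps X))" for j
    using eps_le_1[of X]
    by (subst psum_eq_expand[OF nu]) (simp add: expand_def T eps_f_type)
  have lin: "2 * psum lam (Suc j) = psum lam j + psum lam (Suc (Suc j))" 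
    if "Suc j mod 2 = eps' (f_type X)" "defect X ?T (Suc j) = 0" for j
    using that expand_second_difference[of X ?T j] bd[of "Suc j"]
    by (simp add: psum_eq_expand[OF lam, symmetric])
  have nu_conc: "psum nu j + psum nu (Suc (Suc j)) \<le> 2 * psum nu (Suc j)" for j
    by (rule psum_concave[OF part_nu])
  have xi_props: "2 * psum xi (Suc j) = psum xi j + psum xi (Suc (Suc j))"
      "even (W (f_type X) xi j)" "even (W (f_type X) xi (Suc (Suc j)))"
    if xi: "nilpotent_partition (eps (f_type X)) N' xi" and odd: "odd (W (f_type X) xi (Suc j))" for xi j
  proof -
    have l: "\<And>j. odd (W (f_type X) xi (Suc j)) \<Longrightarrow> row xi j = row xi (Suc j)"
      using xi eps_le_1(1) by (simp add: nilpotent_partition_iff_wsum)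
    show "2 * psum xi (Suc j) = psum xi j + psum xi (Suc (Suc j))"
      using l[OF odd] by (simp add: psum_Suc)
    show "even (W (f_type X) xi j)" "even (W (f_type X) xi (Suc (Suc j)))"
      using wsum_alternates[OF l odd] by simp_all
  qed
  have pm: "(m mod 2 = eps' (f_type X)) \<longleftrightarrow> (Suc m mod 2 \<noteq> eps' (f_type X))" for m
    by (cases X) (auto simp: mod2_eq_if)
  show "psum nu j \<le> psum (pre_collapse X lam) j" for j
  proof (cases "eps X = 1")
    case True
    then have "unit_B X = 0" by (cases X) auto
    with True show ?thesis
      using lam_eq[of j] nu_eq[of j]
      by (cases "j = 0") (auto simp: psum_pre_collapse_odd[OF lam True])
  next
    case False
    then have e: "eps X = 0" using eps_le_1[of X] by simp
    then have u: "unit_B X + unit_D X = 1" "?c = 0" by (cases X; simp)+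
    \<comment> \<open>The cap that lowering the last part puts on the partial sums is the size of
      \<open>nu\<close>.\<close>
    have "psum nu j \<le> int N'"
      using psum_le_total[of nu j] by (simp add: partition_sum[OF part_nu])
    then show ?thesis
      using lam_eq[of j] nu_eq[of j] u N' e
      by (cases "j = 0") (auto simp: psum_pre_collapse_even[OF lam e])
  qed
  fix xi j
  assume xi: "nilpotent_partition (eps (f_type X)) N' xi"
    and le: "\<And>j. psum xi j \<le> psum (pre_collapse X lam) j"
  show "psum xi j \<le> psum nu j"
  proof (cases "eps X = 1")
    case True
    have u: "unit_B X = 0" "?c = int (eps' (f_type X))" and ef: "eps (f_type X) = 0"
      using True by (cases X; simp)+
    have le': "psum xi j \<le> psum lam j + of_bool (0 < j) * ?c" for j
      using le[of j] by (simp add: psum_pre_collapse_odd[OF lam True])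
    have evW: "even (W (f_type X) xi j) \<longleftrightarrow> (odd (psum xi j) \<longleftrightarrow> odd j)" for j
      unfolding even_W_iff by (simp add: ef)
    \<comment> \<open>Outer refers to \<open>f_type X\<close>. An excess at \<open>j\<close> needs a
      zero defect, so \<open>lam\<close> is straight there; parity lowers the bound on
      \<open>xi\<close> at both neighbours by one, too low for a straight \<open>xi\<close>.\<close>
    have outer: "psum xi j \<le> psum nu j" if j: "j mod 2 = eps' (f_type X)" for j
    proof (rule ccontr)
      assume gt: "\<not> ?thesis"
      then obtain i where i: "j = Suc i" by (cases j) auto
      have nb: "i mod 2 \<noteq> eps' (f_type X)" "Suc (Suc i) mod 2 \<noteq> eps' (f_type X)"
        using pm[of i] pm[of j] j i by auto
      have eq: "psum xi j = 2 * ?T j + ?c + 1" "defect X ?T j = 0"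
        using le'[of j] gt lam_eq[of j] nu_eq[of j] j u True i by (auto simp: of_bool_def split: if_splits)
      have "odd (W (f_type X) xi (Suc i))"
        using eq(1) j u i unfolding evW by (auto simp: mod2_eq_if split: if_splits)
      note props = xi_props[OF xi this]
      have small: "psum xi k \<le> 2 * ?T k + ?c - 1"
        if k: "k mod 2 \<noteq> eps' (f_type X)" "even (W (f_type X) xi k)" for k
      proof (cases "k = 0")
        case True
        then show ?thesis
          using k(1) u(2) T0 by (cases X) auto
      next
        case False
        then have "psum xi k \<le> 2 * ?T k + ?c"
          using le'[of k] lam_eq[of k] k u by simp
        moreover have "psum xi k \<noteq> 2 * ?T k + ?c"
          using k u unfolding evW by (cases X) (auto simp: mod2_eq_if split: if_splits)
        ultimately show ?thesis by simp
      qed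
      show False
        using props(1) small[OF nb(1) props(2)] small[OF nb(2) props(3)] eq(1) lin[of i] eq(2) j i
          lam_eq[of j] lam_eq[of i] lam_eq[of "Suc (Suc i)"] nb u True by simp
    qed
    show ?thesis
    proof (rule ccontr)
      assume gt: "\<not> ?thesis"
      then obtain i where i: "j = Suc i" by (cases j) auto
      have j: "j mod 2 \<noteq> eps' (f_type X)"
        using gt outer by blast
      have nb: "i mod 2 = eps' (f_type X)" "Suc (Suc i) mod 2 = eps' (f_type X)"
        using pm[of i] pm[of j] j i by auto
      have eq: "psum xi j = 2 * ?T j + ?c"
        using le'[of j] gt lam_eq[of j] nu_eq[of j] j u True i by (auto simp: of_bool_def split: if_splits)
      have "odd (W (f_type X) xi (Suc i))"
        using eq j u i unfolding evW by (cases X) (auto simp: mod2_eq_if split: if_splits)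
      note props = xi_props[OF xi this]
      show False
        using props(1) outer[OF nb(1)] outer[OF nb(2)] nu_conc[of i] gt i by simp
    qed
  next
    case False
    then have e: "eps X = 0" using eps_le_1[of X] by simp
    then have u: "unit_B X + unit_D X = 1" "?c = 0" and ef: "eps (f_type X) = 1" by (cases X; simp)+
    have evW: "even (W (f_type X) xi j) \<longleftrightarrow> even (psum xi j)" for j
      unfolding even_W_iff by (simp add: ef)
    have le': "psum xi j \<le> 2 * ?T j + 1" for j
      using le[of j] u lam_eq[of j] e T0
      by (cases "j = 0") (auto simp: psum_pre_collapse_even[OF lam e] of_bool_def split: if_splits)
    show ?thesis
    proof (rule ccontr)
      assume gt: "\<not> ?thesis"
      then obtain i where i: "j = Suc i" by (cases j) auto
      have nu_ge: "2 * ?T k \<le> psum nu k" for k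
        using nu_eq[of k] e u by simp
      have eq: "psum xi j = 2 * ?T j + 1"
        using le'[of j] gt nu_ge[of j] by simp
      then have "odd (W (f_type X) xi (Suc i))"
        using i unfolding evW by simp
      note props = xi_props[OF xi this]
      \<comment> \<open>Even \<open>W\<close> here means an even partial sum, so the bound
        \<open>2 * ?T k + 1\<close> improves to \<open>2 * ?T k\<close>.\<close>
      have bound: "psum xi k \<le> psum nu k" if "even (W (f_type X) xi k)" for k
        using that le'[of k] nu_ge[of k] unfolding evW
        by presburger
      show False
        using props(1) bound[OF props(2)] bound[OF props(3)] nu_conc[of i] gt i by simp
    qed
  qed
qed

text \<open>The sequence is admissible for \<open>f_type X\<close> too, hence realized there by a
  partition of the adjusted size, which \<open>f_map_eqI\<close> identifies as the collapse.\<close>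

lemma
  assumes "special_partition X N lam"
  shows f_map_special: "special_partition (f_type X) (nat (int N - unit_B X + unit_B (f_type X))) (f_map X lam)"
    and halfsum_f_map: "halfsum (f_type X) (f_map X lam) = halfsum X lam"
proof -
  obtain n where n: "int N = 2 * int n + unit_B X" "admissible X n (halfsum X lam)"
    using special_admissible[OF assms] by blast
  let ?N = "nat (int N - unit_B X + unit_B (f_type X))"
  have N: "int ?N = 2 * int n + unit_B (f_type X)"
    by (cases X) (simp_all add: n)
  obtain nu where nu: "special_partition (f_type X) ?N nu" "halfsum (f_type X) nu = halfsum X lam"
    using admissible_realize[OF _ N] n(2) by auto
  have "f_map X lam = nu"
    using N n(1) by (intro f_map_eqI[OF assms nu]) simp
  with nu show "special_partition (f_type X) ?N (f_map X lam)"
    "halfsum (f_type X) (f_map X lam) = halfsum X lam"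
    by simp_all
qed

section \<open>Minimal special degenerations as covers of sequences\<close>

definition covers :: "lie_type \<Rightarrow> nat \<Rightarrow> (nat \<Rightarrow> int) \<Rightarrow> (nat \<Rightarrow> int) \<Rightarrow> bool" where
  "covers X n T T' \<longleftrightarrow> T' \<le> T \<and> T' \<noteq> T \<and>
     (\<forall>U. admissible X n U \<and> T' \<le> U \<and> U \<le> T \<longrightarrow> U = T' \<or> U = T)"

lemma special_dominated_iff:
  assumes "special_partition X N lam" "special_partition X N mu"
  shows "mu \<unlhd> lam \<longleftrightarrow> halfsum X mu \<le> halfsum X lam"
  using assms psum_le_iff_halfsum_le[OF assms(2,1)]
  by (simp add: dominated_iff_psum le_fun_def partition_sum[OF special_is_partition])

lemma special_admissible':
  assumes "special_partition X N lam" "int N = 2 * int n + unit_B X"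
  shows "admissible X n (halfsum X lam)"
  using special_admissible[OF assms(1)] assms(2) by auto

lemma minimal_special_degeneration_iff:
  "minimal_special_degeneration (X, lam, mu) \<longleftrightarrow>
    (\<exists>N n. int N = 2 * int n + unit_B X \<and> special_partition X N lam \<and> special_partition X N mu \<and>
      covers X n (halfsum X lam) (halfsum X mu))"
    (is "?lhs \<longleftrightarrow> ?rhs")
proof
  assume ?lhs
  then obtain N where lam: "special_partition X N lam" and mu: "special_partition X N mu"
    and le: "mu \<unlhd> lam" "mu \<noteq> lam"
    and min: "\<And>nu. special_partition X N nu \<Longrightarrow> mu \<unlhd> nu \<Longrightarrow> nu \<unlhd> lam \<Longrightarrow> nu = mu \<or> nu = lam"
    by auto
  obtain n where n: "int N = 2 * int n + unit_B X"
    using special_admissible[OF lam] by blast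
  have "covers X n (halfsum X lam) (halfsum X mu)"
    unfolding covers_def
  proof (intro conjI allI impI)
    show "halfsum X mu \<le> halfsum X lam"
      using le special_dominated_iff[OF lam mu] by simp
    show "halfsum X mu \<noteq> halfsum X lam"
      using le special_eqI[OF mu lam] by blast
    fix U assume U: "admissible X n U \<and> halfsum X mu \<le> U \<and> U \<le> halfsum X lam"
    then obtain nu where "special_partition X N nu" "halfsum X nu = U"
      using admissible_realize[OF _ n] by blast
    with U min[of nu] show "U = halfsum X mu \<or> U = halfsum X lam"
      using special_dominated_iff lam mu by blast
  qed
  with n lam mu show ?rhs by blast
next
  assume ?rhs
  then obtain N n where n: "int N = 2 * int n + unit_B X"
    and lam: "special_partition X N lam" and mu: "special_partition X N mu"
    and cov: "covers X n (halfsum X lam) (halfsum X mu)"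
    by blast
  have "nu = mu \<or> nu = lam"
    if nu: "special_partition X N nu" "mu \<unlhd> nu" "nu \<unlhd> lam" for nu
  proof -
    have "halfsum X nu = halfsum X mu \<or> halfsum X nu = halfsum X lam"
      using cov special_admissible'[OF nu(1) n] special_dominated_iff[OF lam nu(1)]
        special_dominated_iff[OF nu(1) mu] nu by (auto simp: covers_def)
    then show ?thesis
      using special_eqI nu(1) lam mu by blast
  qed
  moreover have "mu \<unlhd> lam" "mu \<noteq> lam"
    using cov special_dominated_iff[OF lam mu] by (auto simp: covers_def)
  ultimately show ?lhs
    using lam mu by auto
qed

lemma minimal_special_degeneration_f:
  assumes "minimal_special_degeneration p"
  shows "minimal_special_degeneration (f_deg p)"
proof -
  obtain X lam mu where p: "p = (X, lam, mu)" by (cases p)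
  then obtain N n where n: "int N = 2 * int n + unit_B X"
    and lam: "special_partition X N lam" and mu: "special_partition X N mu"
    and cov: "covers X n (halfsum X lam) (halfsum X mu)"
    using assms by (auto simp: minimal_special_degeneration_iff simp del: minimal_special_degeneration.simps)
  let ?N = "nat (int N - unit_B X + unit_B (f_type X))"
  have "covers (f_type X) n (halfsum X lam) (halfsum X mu)"
    using cov by (simp add: covers_def)
  moreover have "int (nat (int N - unit_B X + unit_B (f_type X))) = 2 * int n + unit_B (f_type X)"
    by (cases X) (simp_all add: n)
  ultimately show ?thesis
    unfolding p f_deg.simps minimal_special_degeneration_iff halfsum_f_map[OF lam] halfsum_f_map[OF mu]
    using f_map_special[OF lam] f_map_special[OF mu] by blast
qed

text \<open>Conjugation is an order-reversing involution between special partitions of types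
  \<open>X\<close> and \<open>d_type X\<close>, so an intermediate partition on one side gives one
  on the other.\<close>

lemma minimal_special_degeneration_d:
  assumes "minimal_special_degeneration p"
  shows "minimal_special_degeneration (d_deg p)"
proof -
  obtain X lam mu where p: "p = (X, lam, mu)" by (cases p)
  then obtain N where lam: "special_partition X N lam" and mu: "special_partition X N mu"
    and le: "mu \<unlhd> lam" "mu \<noteq> lam"
    and min: "\<And>nu. special_partition X N nu \<Longrightarrow> mu \<unlhd> nu \<Longrightarrow> nu \<unlhd> lam \<Longrightarrow> nu = mu \<or> nu = lam"
    using assms by auto
  note part = special_is_partition
  have inv: "conjugate (conjugate nu) = nu" if "special_partition Y N nu" for Y nu
    using conjugate_conjugate[OF part[OF that]] .
  have rev: "conjugate nu \<unlhd> conjugate kap"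
    if "special_partition Y N nu" "special_partition Y N kap" "kap \<unlhd> nu" for Y nu kap
    using conjugate_dominated[OF part part] that by blast
  have dd: "d_type (d_type X) = X" by (cases X) simp_all
  have "nu = conjugate lam \<or> nu = conjugate mu"
    if nu: "special_partition (d_type X) N nu" "conjugate lam \<unlhd> nu" "nu \<unlhd> conjugate mu" for nu
  proof -
    have "special_partition X N (conjugate nu)"
      using special_conjugate[OF nu(1)] dd by simp
    moreover have "mu \<unlhd> conjugate nu" "conjugate nu \<unlhd> lam"
      using rev[OF special_conjugate[OF mu] nu(1,3)] rev[OF nu(1) special_conjugate[OF lam] nu(2)]
        inv[OF mu] inv[OF lam] by simp_all
    ultimately have "conjugate nu = mu \<or> conjugate nu = lam"
      by (rule min)
    then show ?thesis
      using inv[OF nu(1)] by auto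
  qed
  moreover have "conjugate lam \<unlhd> conjugate mu"
    using rev[OF lam mu le(1)] .
  moreover have "conjugate lam \<noteq> conjugate mu"
    using inv[OF lam] inv[OF mu] le(2) by metis
  ultimately show ?thesis
    unfolding p using special_conjugate[OF lam] special_conjugate[OF mu] by auto
qed

lemma d_LS_deg_eq: "d_LS_deg p = d_deg (f_deg p)"
  by (cases p) (simp add: d_LS_map_def)

section \<open>Covering relations\<close>

lemma defect_diff:
  "0 < j \<Longrightarrow> defect X (\<lambda>k. T k - E k) j = defect X T j - 2 * E j + E (j - 1) + E (Suc j)"
  by (simp add: defect_def)

text \<open>Lowering \<open>T\<close> at \<open>k\<close> moves two units of defect from
  \<open>k\<close> to its neighbours, where position \<open>0\<close> keeps its dummy. Both
  neighbours are then positive, so no new pair of adjacent zeros arises.\<close>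

lemma admissible_lower_one:
  assumes adm: "admissible X n T" and k: "0 < k" "2 \<le> defect X T k"
  shows "admissible X n (\<lambda>j. T j - of_bool (j = k))"
proof -
  let ?E = "\<lambda>j. of_bool (j = k) :: int"
  have nonneg: "\<And>j. 0 \<le> defect X T j" and T0: "T 0 = 0"
    and no_two: "\<And>j. defect X T j \<noteq> 0 \<or> defect X T (Suc j) \<noteq> 0"
    using adm by (auto simp: admissible_def)
  obtain M where M: "\<And>j. M \<le> j \<Longrightarrow> T j = int n"
    using adm by (auto simp: admissible_def)
  have d: "defect X (\<lambda>j. T j - ?E j) j
      = defect X T j - 2 * ?E j + of_bool (Suc k = j \<or> k = Suc j)" if "0 < j" for j
    unfolding defect_diff[OF that] using that by auto
  have d0: "defect X (\<lambda>j. T j - ?E j) 0 = 1"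
    by (simp add: defect_def)
  have "0 \<le> defect X (\<lambda>j. T j - ?E j) j" for j
    using nonneg[of j] k d[of j] d0 by (cases "j = 0") auto
  moreover have "defect X (\<lambda>j. T j - ?E j) j \<noteq> 0 \<or> defect X (\<lambda>j. T j - ?E j) (Suc j) \<noteq> 0" for j
    using nonneg[of j] nonneg[of "Suc j"] no_two[of j] d[of j] d[of "Suc j"] d0
    by (cases "j = 0") (auto simp: of_bool_def split: if_splits)
  moreover have "\<forall>j\<ge>max M (Suc k). T j - ?E j = int n"
    using M by auto
  ultimately show ?thesis
    unfolding admissible_def using T0 k by (intro conjI) (simp, blast+)
qed

text \<open>The defects over the interval of a cover that lowers \<open>T\<close> on \<open>{p..p + 2 * m}\<close> with
  \<open>m \<ge> 1\<close> are \<open>1, 1, 0, 1, 0, \<dots>, 0, 1, 1\<close>.\<close>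

definition alternating :: "lie_type \<Rightarrow> (nat \<Rightarrow> int) \<Rightarrow> nat \<Rightarrow> nat \<Rightarrow> bool" where
  "alternating X T p m \<longleftrightarrow>
     (\<forall>r\<le>2 * m. defect X T (p + r) = of_bool (r = 0 \<or> r = 2 * m \<or> odd r))"

text \<open>One unit of defect moves from each end to the position just outside. The ends become
  zero, but their neighbours are positive: outside by the added unit or the dummy at
  \<open>0\<close>, inside because the pattern has ones there.\<close>

lemma admissible_lower_interval:
  assumes adm: "admissible X n T" and p: "0 < p" "0 < m" and alt: "alternating X T p m"
  shows "admissible X n (\<lambda>j. T j - of_bool (p \<le> j \<and> j \<le> p + 2 * m))"
proof -
  let ?E = "\<lambda>j. of_bool (p \<le> j \<and> j \<le> p + 2 * m) :: int"
  let ?U = "\<lambda>j. T j - ?E j"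
  have nonneg: "\<And>j. 0 \<le> defect X T j" and T0: "T 0 = 0"
    and no_two: "\<And>j. defect X T j \<noteq> 0 \<or> defect X T (Suc j) \<noteq> 0"
    using adm by (auto simp: admissible_def)
  obtain M where M: "\<And>j. M \<le> j \<Longrightarrow> T j = int n"
    using adm by (auto simp: admissible_def)
  have d: "defect X ?U j = defect X T j - of_bool (j = p \<or> j = p + 2 * m)
      + of_bool (Suc j = p \<or> j = Suc (p + 2 * m))" if "0 < j" for j
    unfolding defect_diff[OF that] using that p by (auto simp: of_bool_def)
  have d0: "defect X ?U 0 = 1"
    by (simp add: defect_def)
  have ends: "defect X T p = 1" "defect X T (p + 2 * m) = 1"
    "defect X T (Suc p) = 1" "defect X T (p + 2 * m - 1) = 1"
    using alt[unfolded alternating_def, rule_format, of 0] alt[unfolded alternating_def, rule_format, of "2 * m"]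
      alt[unfolded alternating_def, rule_format, of 1] alt[unfolded alternating_def, rule_format, of "2 * m - 1"] p
    by auto
  have nonneg_U: "0 \<le> defect X ?U j" for j
    using nonneg[of j] p d[of j] d0 ends by (cases "j = 0") auto
  have no_two_U: "defect X ?U j \<noteq> 0 \<or> defect X ?U (Suc j) \<noteq> 0" for j
  proof -
    consider "j = 0" | "j = p" | "Suc j = p" "0 < j" | "j = p + 2 * m" | "Suc j = p + 2 * m"
      | "0 < j" "j \<noteq> p" "Suc j \<noteq> p" "j \<noteq> p + 2 * m" "Suc j \<noteq> p + 2 * m"
      by blast
    then show ?thesis
    proof cases
      case 2
      then show ?thesis using d[of "Suc j"] ends p by auto
    next
      case 3
      then show ?thesis using d[of j] nonneg[of j] by auto
    next
      case 4
      then show ?thesis using d[of "Suc j"] nonneg[of "Suc j"] by auto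
    next
      case 5
      then have "j = p + 2 * m - 1" "0 < j" "j \<noteq> p" "Suc j \<noteq> p" using p by auto
      then show ?thesis using d[of j] ends p by auto
    next
      case 6
      then show ?thesis
        using d[of j] d[of "Suc j"] nonneg[of j] nonneg[of "Suc j"] no_two[of j]
        by (auto simp: of_bool_def split: if_splits)
    qed (use d0 in simp)
  qed
  have "\<forall>j\<ge>max M (Suc (p + 2 * m)). ?U j = int n"
    using M by auto
  then show ?thesis
    unfolding admissible_def using T0 p nonneg_U no_two_U by (intro conjI) (simp, blast+)
qed

text \<open>Take the first run on which \<open>E = T - T'\<close> is positive. If a defect in it is
  at least 2, lowering there already gives \<open>T'\<close>. Otherwise the slope \<open>F\<close>
  of \<open>E\<close> falls from positive to negative although defects are at most 1 and
  \<open>T'\<close> has no two adjacent zero defects. This takes two pairs of adjacent ones; between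
  the first two pairs the defects alternate.\<close>

lemma covers_cases:
  assumes adm: "admissible X n T" and adm': "admissible X n T'" and cov: "covers X n T T'"
  obtains k where "0 < k" "T' = (\<lambda>j. T j - of_bool (j = k))"
  | p m where "0 < p" "0 < m" "alternating X T p m"
      "T' = (\<lambda>j. T j - of_bool (p \<le> j \<and> j \<le> p + 2 * m))"
proof -
  let ?d = "defect X T" and ?d' = "defect X T'"
  have nonneg: "\<And>j. 0 \<le> ?d j" and T0: "T 0 = 0"
    and no_two: "\<And>j. ?d j \<noteq> 0 \<or> ?d (Suc j) \<noteq> 0"
    using adm by (auto simp: admissible_def)
  have nonneg': "\<And>j. 0 \<le> ?d' j" and T0': "T' 0 = 0"
    and no_two': "\<And>j. ?d' j \<noteq> 0 \<or> ?d' (Suc j) \<noteq> 0"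
    using adm' by (auto simp: admissible_def)
  obtain M M' where M: "\<And>j. M \<le> j \<Longrightarrow> T j = int n" and M': "\<And>j. M' \<le> j \<Longrightarrow> T' j = int n"
    using adm adm' unfolding admissible_def by metis
  have le: "T' j \<le> T j" for j
    using cov by (auto simp: covers_def le_fun_def)
  have unique: "T' = U" if "admissible X n U" "\<And>j. T' j \<le> U j" "\<And>j. U j \<le> T j" "U k < T k" for U k
    using cov that by (auto simp: covers_def le_fun_def)
  define E where "E j = T j - T' j" for j
  have E0: "E 0 = 0" and Enn: "0 \<le> E j" for j
    using T0 T0' le[of j] by (simp_all add: E_def)
  define i where "i = (LEAST i. 0 < E i)"
  have "\<exists>i. 0 < E i"
    using cov le by (auto simp: covers_def E_def) (metis antisym_conv1 ext)
  then have Ei: "0 < E i"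
    unfolding i_def by (rule LeastI_ex)
  have before: "E k = 0" if "k < i" for k
    using not_less_Least[of k "\<lambda>i. 0 < E i"] that Enn[of k] by (simp add: i_def)
  have ipos: "0 < i"
    using Ei E0 by (cases i) auto
  define j where "j = (LEAST j. i < j \<and> E j = 0)"
  have "\<exists>j. i < j \<and> E j = 0"
    using M[of "max M (max M' (Suc i))"] M'[of "max M (max M' (Suc i))"]
    by (intro exI[of _ "max M (max M' (Suc i))"]) (simp add: E_def)
  then have j: "i < j \<and> E j = 0"
    unfolding j_def by (rule LeastI_ex)
  then have ij: "i < j" and Ej: "E j = 0" by auto
  have inside: "0 < E k" if "i \<le> k" "k < j" for k
    using not_less_Least[of k "\<lambda>j. i < j \<and> E j = 0"] that Enn[of k] Ei
    by (cases "k = i") (auto simp: j_def)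
  show ?thesis
  proof (cases "\<exists>k. i \<le> k \<and> k < j \<and> 2 \<le> ?d k")
    case True
    then obtain k where k: "i \<le> k" "k < j" "2 \<le> ?d k" by blast
    have "T' = (\<lambda>j. T j - of_bool (j = k))"
      using k ipos le inside[OF k(1,2)]
      by (intro unique[where k = k] admissible_lower_one adm) (auto simp: E_def of_bool_def)
    with k ipos show ?thesis
      by (intro that(1)[of k]) auto
  next
    case False
    then have small: "?d k \<le> 1" if "i \<le> k" "k < j" for k
      using that by force
    define F where "F k = E k - E (k - 1)" for k
    have F_step: "F (Suc k) = F k - (?d k - ?d' k)" if "0 < k" for k
      using that by (simp add: F_def E_def defect_def)
    have Fi: "1 \<le> F i"
      using Ei before[of "i - 1"] ipos by (simp add: F_def)
    have Fj: "F j < 0"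
      using inside[of "j - 1"] ij Ej by (simp add: F_def)
    define occ where "occ q \<longleftrightarrow> i \<le> q \<and> Suc q < j \<and> ?d q = 1 \<and> ?d (Suc q) = 1" for q
    have step1: "F k - 1 \<le> F (Suc k)" if "i \<le> k" "k < j" for k
      using F_step[of k] small[OF that] nonneg'[of k] that ipos by simp
    \<comment> \<open>Two consecutive defects of \<open>T'\<close> add up to at least 1, those of
      \<open>T\<close> in the run to at most 1 unless \<open>occ k\<close>.\<close>
    have step2: "F k - of_bool (occ k) \<le> F (Suc (Suc k))" if "i \<le> k" "Suc k < j" for k
    proof -
      have "1 \<le> ?d' k + ?d' (Suc k)"
        using nonneg'[of k] nonneg'[of "Suc k"] no_two'[of k] by linarith
      moreover have "?d k + ?d (Suc k) \<le> 1 + of_bool (occ k)"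
        using small[of k] small[of "Suc k"] nonneg[of k] nonneg[of "Suc k"] that
        by (auto simp: occ_def)
      ultimately show ?thesis
        using F_step[of k] F_step[of "Suc k"] that ipos by simp
    qed
    have inv: "0 \<le> F k \<and> 0 \<le> F (Suc k) \<and> (1 \<le> F k \<or> 1 \<le> F (Suc k))"
      if "i \<le> k" "Suc k \<le> j" "\<And>q. q < k \<Longrightarrow> \<not> occ q" for k
      using that
    proof (induction k rule: dec_induct)
      case base
      then show ?case
        using Fi step1[of i] by simp
    next
      case (step k)
      then have "\<not> occ k" by auto
      with step step2[of k] show ?case
        by auto
    qed
    have "\<exists>p. occ p"
    proof (rule ccontr)
      assume "\<not> ?thesis"
      moreover obtain l where "j = Suc l" "i \<le> l"
        using ij by (cases j) auto
      ultimately show False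
        using inv[of l] Fj by auto
    qed
    define p where "p = (LEAST p. occ p)"
    have p: "occ p"
      unfolding p_def using \<open>\<exists>p. occ p\<close> by (rule LeastI_ex)
    have first: "\<not> occ q" if "q < p" for q
      using not_less_Least[of q occ] that by (simp add: p_def)
    have p': "i \<le> p" "Suc p < j" "?d p = 1" "?d (Suc p) = 1"
      using p by (auto simp: occ_def)
    \<comment> \<open>The first pair costs at most one unit and leaves \<open>F\<close> nonnegative;
      only a second pair can make it negative.\<close>
    have "\<exists>q. p < q \<and> occ q"
    proof (rule ccontr)
      assume none: "\<not> ?thesis"
      have "0 \<le> F k \<and> 0 \<le> F (Suc k)" if "Suc p \<le> k" "Suc k \<le> j" for k
        using that
      proof (induction k rule: dec_induct)
        case base
        have "0 \<le> F p \<and> 0 \<le> F (Suc p) \<and> (1 \<le> F p \<or> 1 \<le> F (Suc p))"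
          using inv[of p] first p' by simp
        then show ?case
          using step1[of "Suc p"] step2[of p] p p' by auto
      next
        case (step k)
        then have "\<not> occ k"
          using none by (meson Suc_le_lessD)
        with step step2[of k] p' show ?case
          by simp
      qed
      moreover obtain l where "j = Suc l" "Suc p \<le> l"
        using p' by (cases j) auto
      ultimately show False
        using Fj by fastforce
    qed
    define q where "q = (LEAST q. p < q \<and> occ q)"
    have q: "p < q \<and> occ q"
      unfolding q_def using \<open>\<exists>q. p < q \<and> occ q\<close> by (rule LeastI_ex)
    have second: "\<not> occ r" if "p < r" "r < q" for r
      using not_less_Least[of r "\<lambda>q. p < q \<and> occ q"] that by (simp add: q_def)
    have q': "p < q" "Suc q < j" "?d q = 1" "?d (Suc q) = 1"
      using q by (auto simp: occ_def)
    have alt: "?d (Suc p + r) = of_bool (even r)" if "Suc p + r \<le> q" for r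
      using that
    proof (induction r)
      case (Suc r)
      let ?k = "Suc p + r"
      have "\<not> occ ?k"
        using second[of ?k] Suc.prems by simp
      moreover have "i \<le> ?k" "Suc ?k < j" "?d (Suc ?k) \<le> 1"
        using Suc.prems p' q' small[of "Suc ?k"] by auto
      ultimately show ?case
        using Suc no_two[of ?k] nonneg[of "Suc ?k"] by (auto simp: occ_def)
    qed (simp add: p')
    have "even (q - Suc p)"
      using alt[of "q - Suc p"] q' by (auto simp: of_bool_def split: if_splits)
    then obtain t where "q - Suc p = 2 * t"
      by blast
    with q' have t: "q = Suc p + 2 * t" by simp
    \<comment> \<open>The interval runs from the start of the first pair to the end
      \<open>Suc q\<close> of the second; pairs sharing a position give \<open>t = 0\<close>,
      \<open>m = 1\<close>.\<close>
    define m where "m = Suc t"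
    have m: "p + 2 * m = Suc q" "0 < m"
      by (simp_all add: m_def t)
    have alternating: "alternating X T p m"
      unfolding alternating_def
    proof (intro allI impI)
      fix r assume r: "r \<le> 2 * m"
      show "?d (p + r) = of_bool (r = 0 \<or> r = 2 * m \<or> odd r)"
      proof (cases r)
        case (Suc s)
        show ?thesis
        proof (cases "r = 2 * m")
          case True
          then show ?thesis using m q' by simp
        next
          case False
          then have "Suc p + s \<le> q"
            using r Suc m by simp
          from alt[OF this] show ?thesis
            using Suc False by auto
        qed
      qed (simp add: p')
    qed
    have "T' = (\<lambda>j. T j - of_bool (p \<le> j \<and> j \<le> p + 2 * m))"
    proof (intro unique[where k = p] admissible_lower_interval adm alternating)
      fix k
      show "T' k \<le> T k - of_bool (p \<le> k \<and> k \<le> p + 2 * m)"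
        using le[of k] inside[of k] p' q' m by (auto simp: E_def of_bool_def)
    qed (use p' ipos m in auto)
    with alternating m p' ipos show ?thesis
      by (intro that(2)[of p m]) auto
  qed
qed

section \<open>Removing common rows and columns\<close>

lemma common_prefix_length_eqI:
  assumes "l < length xs" "l < length ys" "xs ! l \<noteq> ys ! l" "\<And>i. i < l \<Longrightarrow> xs ! i = ys ! i"
  shows "common_prefix_length xs ys = l"
  using assms
proof (induction xs ys arbitrary: l rule: longest_common_prefix.induct)
  case (1 x xs y ys)
  show ?case
  proof (cases l)
    case (Suc k)
    have "common_prefix_length xs ys = k" "x = y"
      using "1.prems" "1.prems"(4)[of 0] "1.prems"(4)[of "Suc _"] Suc
      by (auto intro!: "1.IH")
    then show ?thesis
      by (simp add: common_prefix_length_def Suc)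
  qed (use "1.prems" in \<open>simp add: common_prefix_length_def\<close>)
qed auto

abbreviation valid :: "nat list \<Rightarrow> bool" where
  "valid lam \<equiv> is_partition (sum_list lam) lam"

lemma is_partition_drop: "is_partition N lam \<Longrightarrow> valid (drop l lam)"
  by (auto simp: is_partition_def sorted_wrt_drop dest: in_set_dropD)

lemma row_drop: "row (drop l lam) i = row lam (l + i)"
  by (auto simp: nth_default_def)

lemma nat_eqI_less: "(\<And>k. k < a \<longleftrightarrow> k < b) \<Longrightarrow> a = (b :: nat)"
  by (meson linorder_neqE_nat less_irrefl)

text \<open>In terms of the cells of the Young diagrams: away from the first \<open>l\<close> rows and \<open>s\<close> columns, on
  which \<open>lam\<close> and \<open>mu\<close> agree, the diagrams are those of \<open>a\<close> and \<open>b\<close>. This form is invariant under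
  transposition.\<close>

definition reduces :: "nat \<Rightarrow> nat \<Rightarrow> nat list \<Rightarrow> nat list \<Rightarrow> nat list \<Rightarrow> nat list \<Rightarrow> bool" where
  "reduces l s a b lam mu \<longleftrightarrow>
     valid lam \<and> valid mu \<and> valid a \<and> valid b \<and>
     0 < length a \<and> 0 < length b \<and> row a 0 \<noteq> row b 0 \<and> length a \<noteq> length b \<and>
     (\<forall>i j. i < l \<or> j < s \<longrightarrow> (j < row lam i \<longleftrightarrow> j < row mu i)) \<and>
     (\<forall>i j. s + j < row lam (l + i) \<longleftrightarrow> j < row a i) \<and>
     (\<forall>i j. s + j < row mu (l + i) \<longleftrightarrow> j < row b i)"

lemma row_conjugate_0: "is_partition N lam \<Longrightarrow> row (conjugate lam) 0 = length lam"
  by (rule nat_eqI_less) (simp add: less_row_conjugate_iff partition_row_pos)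

lemma length_conjugate: "is_partition N lam \<Longrightarrow> length (conjugate lam) = row lam 0"
  using row_conjugate_0[OF conjugate_partition] conjugate_conjugate by metis

lemma reduces_conjugate:
  assumes "reduces l s a b lam mu"
  shows "reduces s l (conjugate b) (conjugate a) (conjugate mu) (conjugate lam)"
proof -
  have parts: "valid lam" "valid mu" "valid a" "valid b"
    using assms by (auto simp: reduces_def)
  have conj: "valid (conjugate nu)" if "valid nu" for nu
    using conjugate_partition[OF that] partition_sum[OF conjugate_partition[OF that]] by simp
  have "0 < row a 0" "0 < row b 0"
    using assms partition_row_pos[OF parts(3), of 0] partition_row_pos[OF parts(4), of 0]
    by (auto simp: reduces_def)
  then have "0 < length (conjugate a)" "0 < length (conjugate b)"
    by (simp_all only: length_conjugate[OF parts(3)] length_conjugate[OF parts(4)])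
  then show ?thesis
    using assms conj
    by (auto simp: reduces_def length_conjugate row_conjugate_0 less_row_conjugate_iff)
qed

lemma remove_columns_eqI:
  assumes "valid lam" "valid a" "\<And>i j. s + j < row lam i \<longleftrightarrow> j < row a i"
  shows "remove_columns s lam = a"
proof (rule partition_eqI[OF _ assms(2)])
  have p: "valid (drop s (conjugate lam))"
    by (rule is_partition_drop[OF conjugate_partition[OF assms(1)]])
  then show "is_partition (sum_list (drop s (conjugate lam))) (remove_columns s lam)"
    unfolding remove_columns_def by (rule conjugate_partition)
  fix i
  show "row (remove_columns s lam) i = row a i"
    by (rule nat_eqI_less)
      (simp add: remove_columns_def less_row_conjugate_iff[OF p] row_drop
        less_row_conjugate_iff[OF assms(1)] assms(3))
qed

text \<open>The first rows of \<open>a\<close> and \<open>b\<close> differ, which stops the removal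
  of rows exactly at \<open>l\<close>; their numbers of parts differ, which stops the removal of
  columns exactly at \<open>s\<close>.\<close>

lemma has_singularityI:
  assumes red: "reduces l s a b lam mu" and sing: "reduced_singularity X l s a b t"
  shows "has_singularity (X, lam, mu) t"
proof -
  have parts: "valid lam" "valid mu" "valid a" "valid b"
    and ne: "0 < length a" "0 < length b" "row a 0 \<noteq> row b 0" "length a \<noteq> length b"
    and common: "\<And>i j. i < l \<or> j < s \<Longrightarrow> j < row lam i \<longleftrightarrow> j < row mu i"
    and cells: "\<And>i j. s + j < row lam (l + i) \<longleftrightarrow> j < row a i" "\<And>i j. s + j < row mu (l + i) \<longleftrightarrow> j < row b i"
    using red by (auto simp: reduces_def)
  have pos: "0 < row a 0" "0 < row b 0"
    using ne partition_row_pos[OF parts(3), of 0] partition_row_pos[OF parts(4), of 0] by auto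
  have corner: "s < row lam l" "s < row mu l"
    using cells[of 0 0] pos by simp_all
  have "row lam l = s + row a 0" "row mu l = s + row b 0"
    using cells(1)[of "row a 0" 0] cells(1)[of "row a 0 - 1" 0]
      cells(2)[of "row b 0" 0] cells(2)[of "row b 0 - 1" 0] pos by simp_all
  then have rows: "row lam l \<noteq> row mu l"
    using ne by simp
  have len: "l < length lam" "l < length mu"
    using corner partition_row_pos[OF parts(1), of l] partition_row_pos[OF parts(2), of l] by simp_all
  have "common_rows lam mu = l"
    unfolding common_rows_def
  proof (rule common_prefix_length_eqI[OF len])
    show "lam ! l \<noteq> mu ! l"
      using rows len by (simp add: nth_default_nth)
    fix i assume "i < l"
    then have "row lam i = row mu i"
      using common by (intro nat_eqI_less) simp
    with \<open>i < l\<close> len show "lam ! i = mu ! i"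
      by (simp add: nth_default_nth)
  qed
  moreover
  let ?lam = "drop l lam" and ?mu = "drop l mu"
  have dparts: "valid ?lam" "valid ?mu"
    using is_partition_drop[OF parts(1)] is_partition_drop[OF parts(2)] by blast+
  note gal = less_row_conjugate_iff[OF dparts(1)] less_row_conjugate_iff[OF dparts(2)]
  have col: "row (conjugate ?lam) s = length a" "row (conjugate ?mu) s = length b"
    using cells(1)[of 0] cells(2)[of 0] partition_row_pos[OF parts(3)] partition_row_pos[OF parts(4)]
    by (auto intro!: nat_eqI_less simp: gal row_drop)
  have "common_columns ?lam ?mu = s"
    unfolding common_columns_def
  proof (rule common_prefix_length_eqI)
    show len: "s < length (conjugate ?lam)" "s < length (conjugate ?mu)"
      using col ne partition_row_pos[OF conjugate_partition[OF dparts(1)], of s]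
        partition_row_pos[OF conjugate_partition[OF dparts(2)], of s] by simp_all
    show "conjugate ?lam ! s \<noteq> conjugate ?mu ! s"
      using col ne len by (simp add: nth_default_nth)
    fix j assume "j < s"
    then have "row (conjugate ?lam) j = row (conjugate ?mu) j"
      using common by (intro nat_eqI_less) (simp add: gal row_drop)
    with \<open>j < s\<close> len show "conjugate ?lam ! j = conjugate ?mu ! j"
      by (simp add: nth_default_nth)
  qed
  moreover have "remove_columns s ?lam = a" "remove_columns s ?mu = b"
    by (intro remove_columns_eqI dparts parts; simp add: row_drop cells)+
  ultimately show ?thesis
    using sing by (simp add: Let_def)
qed

text \<open>As \<open>a\<close> has fewer parts than \<open>b\<close>, the row of \<open>lam\<close>
  with index \<open>l + length b - 1\<close> has length exactly \<open>s\<close>, which bounds all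
  later rows.\<close>

lemma reducesI:
  assumes "is_partition N lam" "is_partition N' mu" "valid a" "valid b"
    and len: "0 < length a" "length a < length b" and hd: "row a 0 \<noteq> row b 0"
    and above: "\<And>i. i < l \<Longrightarrow> row lam i = row mu i"
    and at: "\<And>i. i < length b \<Longrightarrow> row lam (l + i) = s + row a i"
      "\<And>i. i < length b \<Longrightarrow> row mu (l + i) = s + row b i"
    and below: "\<And>i. l + length b \<le> i \<Longrightarrow> row lam i = row mu i"
  shows "reduces l s a b lam mu"
proof -
  have low: "row lam i \<le> s" if "l + length b \<le> i" for i
  proof -
    have "row lam i \<le> row lam (l + (length b - 1))"
      using that len by (intro partition_row_antimono[OF assms(1)]) simp
    also have "\<dots> = s"
      using at(1)[of "length b - 1"] len by (auto simp: nth_default_def)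
    finally show ?thesis .
  qed
  have eq: "row lam i = row mu i" if "i < l \<or> l + length b \<le> i" for i
    using that above below by blast
  have split: "i < l \<or> l + length b \<le> i \<or> (\<exists>k<length b. i = l + k)" for i
    by presburger
  have common: "j < row lam i \<longleftrightarrow> j < row mu i" if "i < l \<or> j < s" for i j
    using split[of i] eq[of i] at that by auto
  have cell_a: "s + j < row lam (l + i) \<longleftrightarrow> j < row a i" for i j
    using at(1)[of i] low[of "l + i"] len by (cases "i < length b") (auto simp: nth_default_def)
  have cell_b: "s + j < row mu (l + i) \<longleftrightarrow> j < row b i" for i j
    using at(2)[of i] low[of "l + i"] below[of "l + i"] by (cases "i < length b") (auto simp: nth_default_def)
  have "valid lam" "valid mu"
    using assms(1,2) partition_sum[OF assms(1)] partition_sum[OF assms(2)] by simp_all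
  moreover have "0 < length b" "length a \<noteq> length b"
    using len by auto
  ultimately show ?thesis
    unfolding reduces_def using assms(3,4) len(1) hd common cell_a cell_b by blast
qed

section \<open>Conjugates of the reduced pairs\<close>

lemma conjugate_eqI:
  assumes "largest_part lam = length nu" "\<And>j. j < length nu \<Longrightarrow> height lam (Suc j) = nu ! j"
  shows "conjugate lam = nu"
  using assms by (intro nth_equalityI) (simp_all add: conjugate_def del: upt_Suc)

lemma conjugate_row: "conjugate [x] = replicate x 1"
  by (rule conjugate_eqI) (simp_all add: largest_part_def height_def)

lemma conjugate_two_rows: "conjugate [x, x] = replicate x 2"
  by (rule conjugate_eqI) (simp_all add: largest_part_def height_def)

lemma conjugate_row_2: "2 \<le> x \<Longrightarrow> conjugate [x, 2] = [2, 2] @ replicate (x - 2) 1"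
  by (rule conjugate_eqI) (auto simp: largest_part_def height_def nth_append nth_Cons' less_2_cases_iff)

lemma conjugate_hook: "1 \<le> x \<Longrightarrow> conjugate [x, 1, 1] = 3 # replicate (x - 1) 1"
  by (rule conjugate_eqI) (auto simp: largest_part_def height_def nth_Cons')

lemma conjugate_two_rows_2: "2 \<le> x \<Longrightarrow> conjugate [x, x, 2] = [3, 3] @ replicate (x - 2) 2"
  by (rule conjugate_eqI) (auto simp: largest_part_def height_def nth_append nth_Cons' less_2_cases_iff)

lemma conjugate_double_hook: "1 \<le> x \<Longrightarrow> conjugate [x, x, 1, 1] = 4 # replicate (x - 1) 2"
  by (rule conjugate_eqI) (auto simp: largest_part_def height_def nth_Cons')

section \<open>Reduced pairs of the covers\<close>

lemma row_diff:
  assumes "\<And>k. psum lam k = psum mu k + E k"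
  shows "int (row lam i) = int (row mu i) + E (Suc i) - E i"
  using assms[of i] assms[of "Suc i"] by (simp add: psum_Suc)

lemma second_difference_rows:
  "2 * psum lam (Suc i) - psum lam i - psum lam (Suc (Suc i)) = int (row lam i) - int (row lam (Suc i))"
  by (simp add: psum_Suc)

lemma mod_2_neq_Suc: "k mod 2 \<noteq> eps' X \<longleftrightarrow> Suc k mod 2 = eps' X"
  using eps_le_1(2)[of X] by presburger

text \<open>The neighbours of an inner position are outer, where \<open>expand\<close> ignores
  defects. So a single partial sum changes and only rows \<open>l\<close> and \<open>Suc l\<close>
  differ; their drop in \<open>lam\<close> is \<open>2 * n\<close>.\<close>

lemma reduces_inner:
  assumes lam: "special_partition X N lam" and mu: "special_partition X N mu"
    and T: "halfsum X mu = (\<lambda>k. halfsum X lam k - of_bool (k = Suc l))"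
    and inner: "Suc l mod 2 \<noteq> eps' X"
    and d: "defect X (halfsum X lam) (Suc l) = int n + 1" and n: "1 \<le> n"
  obtains s where "s mod 2 \<noteq> eps X"
    "reduces l s [2 * n] (if n = 1 then [1, 1] else [2 * n - 2, 2]) lam mu"
proof -
  let ?T = "halfsum X lam" and ?T' = "halfsum X mu"
  \<comment> \<open>For \<open>n = 1\<close> the defect falls from 2 to 0, and the term for zero
    defects in \<open>expand\<close> restores one of the two units.\<close>
  let ?e = "2 - of_bool (n = 1) :: int"
  have def': "defect X ?T' k = defect X ?T k - 2 * of_bool (k = Suc l) + of_bool (k = l \<or> k = Suc (Suc l))"
    if "0 < k" for k
    unfolding T defect_diff[OF that] using that by auto
  have nb: "l mod 2 = eps' X" "Suc (Suc l) mod 2 = eps' X"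
    using inner mod_2_neq_Suc by auto
  have E: "psum lam k = psum mu k + of_bool (k = Suc l) * ?e" for k
  proof (cases "k = Suc l")
    case True
    then show ?thesis
      unfolding psum_eq_expand[OF lam] psum_eq_expand[OF mu] expand_def
      using inner d n def'[of "Suc l"] by (auto simp: T)
  next
    case False
    have "defect X ?T' k = defect X ?T k" if "k mod 2 \<noteq> eps' X"
    proof (cases "k = 0")
      case k: False
      from that nb have "k \<noteq> l" "k \<noteq> Suc (Suc l)" by auto
      with False def'[of k] k show ?thesis by simp
    qed (simp add: defect_def)
    with False show ?thesis
      unfolding psum_eq_expand[OF lam] psum_eq_expand[OF mu] expand_def
      by (auto simp: T)
  qed
  define s where "s = row lam (Suc l)"
  have r: "row lam l = s + 2 * n"
    using expand_second_difference[of X ?T l] inner d n second_difference_rows[of lam l]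
    by (simp add: psum_eq_expand[OF lam, symmetric] s_def)
  note rows = row_diff[of lam mu, OF E]
  have mu_rows: "int (row mu l) = int s + 2 * int n - ?e" "int (row mu (Suc l)) = int s + ?e"
    using rows[of l] rows[of "Suc l"] r by (simp_all add: s_def)
  have other: "row lam i = row mu i" if "i \<noteq> l" "i \<noteq> Suc l" for i
    using rows[of i] that by simp
  have "psum lam (Suc (Suc l)) - psum lam (Suc l)
      = 2 * (?T (Suc (Suc l)) - ?T (Suc l)) + (1 - int (eps X))"
    unfolding psum_eq_expand[OF lam] expand_def using inner nb d n by simp
  then have "int s = 2 * (?T (Suc (Suc l)) - ?T (Suc l)) + (1 - int (eps X))"
    by (simp add: psum_Suc s_def)
  then have s: "s mod 2 \<noteq> eps X"
    using eps_le_1(1)[of X] by presburger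
  let ?b = "if n = 1 then [1, 1] else [2 * n - 2, 2]"
  have "reduces l s [2 * n] ?b lam mu"
  proof (rule reducesI[OF special_is_partition[OF lam] special_is_partition[OF mu]])
    show "valid [2 * n]" "valid ?b"
      using n by (auto simp: is_partition_def)
    show "row lam (l + i) = s + row [2 * n] i" if "i < length ?b" for i
      using that r by (auto simp: less_Suc_eq s_def split: if_splits)
    show "row mu (l + i) = s + row ?b i" if "i < length ?b" for i
      using that mu_rows n by (auto simp: less_Suc_eq split: if_splits)
  qed (use other n in \<open>auto split: if_splits\<close>)
  with s that show ?thesis by blast
qed

text \<open>The partial sum at the outer position falls by 2. At a neighbour with zero defect it
  falls by 1, since the defect becomes 1 and the extra unit in \<open>expand\<close> is lost. Each
  such neighbour extends the shape by one row on its side, which gives the four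
  alternatives.\<close>

lemma reduces_outer:
  assumes lam: "special_partition X N lam" and mu: "special_partition X N mu"
    and T: "halfsum X mu = (\<lambda>k. halfsum X lam k - of_bool (k = Suc l))"
    and bd: "Suc l mod 2 = eps' X"
    and d: "defect X (halfsum X lam) (Suc l) = int n + 1" and n: "1 \<le> n"
  obtains s where "s mod 2 \<noteq> eps X" "reduces l s [2 * n + 2] [2 * n, 2] lam mu"
  | s where "s mod 2 = eps X" "reduces l s [2 * n + 1] [2 * n - 1, 1, 1] lam mu"
  | s l' where "l = Suc l'" "s mod 2 \<noteq> eps X"
      "reduces l' s [2 * n + 1, 2 * n + 1] [2 * n, 2 * n, 2] lam mu"
  | s l' where "l = Suc l'" "s mod 2 = eps X"
      "reduces l' s [2 * n, 2 * n] [2 * n - 1, 2 * n - 1, 1, 1] lam mu"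
proof -
  let ?T = "halfsum X lam" and ?T' = "halfsum X mu"
  define \<alpha> where "\<alpha> \<longleftrightarrow> defect X ?T l = 0"
  define \<beta> where "\<beta> \<longleftrightarrow> defect X ?T (Suc (Suc l)) = 0"
  have nonneg: "\<And>k. 0 \<le> defect X ?T k"
    using special_admissible[OF lam] by (auto simp: admissible_def)
  have def': "defect X ?T' k = defect X ?T k - 2 * of_bool (k = Suc l) + of_bool (k = l \<or> k = Suc (Suc l))"
    if "0 < k" for k
    unfolding T defect_diff[OF that] using that by auto
  have nb: "l mod 2 \<noteq> eps' X" "Suc (Suc l) mod 2 \<noteq> eps' X"
    using bd mod_2_neq_Suc[of l] mod_2_neq_Suc[of "Suc l"] by auto
  \<comment> \<open>The dummy defect at \<open>0\<close> is nonzero, so there is a row above row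
    \<open>l\<close> whenever \<alpha> holds.\<close>
  have \<alpha>0: "\<alpha> \<Longrightarrow> l \<noteq> 0"
    by (rule notI) (simp add: \<alpha>_def defect_def)
  have E: "psum lam k = psum mu k +
      (2 * of_bool (k = Suc l) + of_bool (k = l \<and> \<alpha>) + of_bool (k = Suc (Suc l) \<and> \<beta>))" for k
  proof -
    consider "k = Suc l" | "k = l" | "k = Suc (Suc l)" | "k \<noteq> l" "k \<noteq> Suc l" "k \<noteq> Suc (Suc l)"
      by blast
    then show ?thesis
    proof cases
      case 1
      then show ?thesis
        unfolding psum_eq_expand[OF lam] psum_eq_expand[OF mu] expand_def using bd by (simp add: T)
    next
      case 2
      then show ?thesis
      proof (cases "l = 0")
        case False
        then show ?thesis
          unfolding psum_eq_expand[OF lam] psum_eq_expand[OF mu] expand_def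
          using 2 nb def'[of l] nonneg[of l] by (auto simp: \<alpha>_def T)
      qed (use \<alpha>0 in auto)
    next
      case 3
      then show ?thesis
        unfolding psum_eq_expand[OF lam] psum_eq_expand[OF mu] expand_def
        using nb def'[of k] nonneg[of k] by (auto simp: \<beta>_def T)
    next
      case 4
      then have "defect X ?T' k = defect X ?T k"
        using def'[of k] by (cases "k = 0") (auto simp: defect_def)
      with 4 show ?thesis
        unfolding psum_eq_expand[OF lam] psum_eq_expand[OF mu] expand_def by (auto simp: T)
    qed
  qed
  define s where "s = row lam (Suc l)"
  have "int (row lam l) - int s = 2 * (int n + 1) - of_bool \<alpha> - of_bool \<beta>"
    using expand_second_difference[of X ?T l] bd d second_difference_rows[of lam l]
    by (simp add: psum_eq_expand[OF lam, symmetric] s_def \<alpha>_def \<beta>_def)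
  then have r: "int (row lam l) = int s + 2 * (int n + 1) - of_bool \<alpha> - of_bool \<beta>"
    by simp
  have linear: "row lam i = row lam (Suc i)" if "Suc i mod 2 \<noteq> eps' X" "defect X ?T (Suc i) = 0" for i
    using expand_second_difference[of X ?T i] that second_difference_rows[of lam i]
    by (simp add: psum_eq_expand[OF lam, symmetric])
  have r\<beta>: "row lam (Suc (Suc l)) = s" if \<beta>
    using linear[of "Suc l"] nb that by (simp add: s_def \<beta>_def)
  have r\<alpha>: "row lam l' = row lam l" if \<alpha> "l = Suc l'" for l'
    using linear[of l'] nb that by (simp add: \<alpha>_def)
  note rows = row_diff[of lam mu, OF E]
  have mu_rows: "int (row mu l) = int (row lam l) - 2 + of_bool \<alpha>"
      "int (row mu (Suc l)) = int s + 2 - of_bool \<beta>"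
      "int (row mu (Suc (Suc l))) = int (row lam (Suc (Suc l))) + of_bool \<beta>"
      "\<And>l'. l = Suc l' \<Longrightarrow> int (row mu l') = int (row lam l') - of_bool \<alpha>"
    using rows[of l] rows[of "Suc l"] rows[of "Suc (Suc l)"] rows[of "l - 1"] by (auto simp: s_def)
  have other: "row lam i = row mu i"
    if "Suc i \<noteq> l \<or> \<not> \<alpha>" "i \<noteq> l" "i \<noteq> Suc l" "i \<noteq> Suc (Suc l) \<or> \<not> \<beta>" for i
    using rows[of i] that by auto
  have "psum lam (Suc (Suc l)) - psum lam (Suc l)
      = 2 * (?T (Suc (Suc l)) - ?T (Suc l)) + of_bool \<beta> - (1 - int (eps X))"
    unfolding psum_eq_expand[OF lam] expand_def using bd nb by (simp add: \<beta>_def)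
  then have "int s = 2 * (?T (Suc (Suc l)) - ?T (Suc l)) + of_bool \<beta> - (1 - int (eps X))"
    by (simp add: psum_Suc s_def)
  then have s: "s mod 2 = eps X \<longleftrightarrow> \<beta>"
    using eps_le_1(1)[of X] by (cases \<beta>; simp; presburger)
  note redI = reducesI[OF special_is_partition[OF lam] special_is_partition[OF mu]]
  show ?thesis
  proof (cases \<alpha>)
    case False
    show ?thesis
    proof (cases \<beta>)
      case False
      have "reduces l s [2 * n + 2] [2 * n, 2] lam mu"
      proof (rule redI)
        show "valid [2 * n + 2]" "valid [2 * n, 2]"
          using n by (auto simp: is_partition_def)
        show "row lam (l + i) = s + row [2 * n + 2] i" if "i < length [2 * n, 2]" for i
          using that r False \<open>\<not> \<alpha>\<close> by (auto simp: less_Suc_eq s_def)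
        show "row mu (l + i) = s + row [2 * n, 2] i" if "i < length [2 * n, 2]" for i
          using that mu_rows r False \<open>\<not> \<alpha>\<close> by (auto simp: less_Suc_eq)
      qed (use other False \<open>\<not> \<alpha>\<close> in auto)
      with that(1) s False show ?thesis by blast
    next
      case True
      have "reduces l s [2 * n + 1] [2 * n - 1, 1, 1] lam mu"
      proof (rule redI)
        show "valid [2 * n + 1]" "valid [2 * n - 1, 1, 1]"
          using n by (auto simp: is_partition_def)
        show "row lam (l + i) = s + row [2 * n + 1] i" if "i < length [2 * n - 1, 1, 1]" for i
          using that r r\<beta> True \<open>\<not> \<alpha>\<close> by (auto simp: less_Suc_eq s_def)
        show "row mu (l + i) = s + row [2 * n - 1, 1, 1] i" if "i < length [2 * n - 1, 1, 1]" for i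
          using that mu_rows r r\<beta> True \<open>\<not> \<alpha>\<close> n by (auto simp: less_Suc_eq)
      qed (use other True \<open>\<not> \<alpha>\<close> in auto)
      with that(2) s True show ?thesis by blast
    qed
  next
    case True
    then obtain l' where l': "l = Suc l'"
      using \<alpha>0 by (cases l) auto
    note rl' = r\<alpha>[OF True l'] mu_rows(4)[OF l']
    show ?thesis
    proof (cases \<beta>)
      case False
      have "reduces l' s [2 * n + 1, 2 * n + 1] [2 * n, 2 * n, 2] lam mu"
      proof (rule redI)
        show "valid [2 * n + 1, 2 * n + 1]" "valid [2 * n, 2 * n, 2]"
          using n by (auto simp: is_partition_def)
        show "row lam (l' + i) = s + row [2 * n + 1, 2 * n + 1] i" if "i < length [2 * n, 2 * n, 2]" for i
          using that r rl' False True l' by (auto simp: less_Suc_eq s_def)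
        show "row mu (l' + i) = s + row [2 * n, 2 * n, 2] i" if "i < length [2 * n, 2 * n, 2]" for i
          using that mu_rows r rl' False True l' by (auto simp: less_Suc_eq)
      qed (use other False True l' in auto)
      with that(3) s False l' show ?thesis by blast
    next
      case \<beta>: True
      have "reduces l' s [2 * n, 2 * n] [2 * n - 1, 2 * n - 1, 1, 1] lam mu"
      proof (rule redI)
        show "valid [2 * n, 2 * n]" "valid [2 * n - 1, 2 * n - 1, 1, 1]"
          using n by (auto simp: is_partition_def)
        show "row lam (l' + i) = s + row [2 * n, 2 * n] i"
          if "i < length [2 * n - 1, 2 * n - 1, 1, 1]" for i
          using that r r\<beta> rl' \<beta> True l' by (auto simp: less_Suc_eq s_def)
        show "row mu (l' + i) = s + row [2 * n - 1, 2 * n - 1, 1, 1] i"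
          if "i < length [2 * n - 1, 2 * n - 1, 1, 1]" for i
          using that mu_rows r r\<beta> rl' \<beta> True l' n by (auto simp: less_Suc_eq)
      qed (use other \<beta> True l' n in auto)
      with that(4) s \<beta> l' show ?thesis by blast
    qed
  qed
qed

lemma psum_eq_sum: "psum xs L = (\<Sum>i<L. int (row xs i))"
  by (induction L) (simp_all add: psum_Suc)

lemma psum_conjugate_eq_sum:
  assumes "is_partition N lam" "length lam \<le> L"
  shows "psum (conjugate lam) k = (\<Sum>i<L. int (min k (row lam i)))"
proof -
  have "row (map (min k) lam) i = min k (row lam i)" for i
    by (simp add: nth_default_def)
  then show ?thesis
    using psum_conjugate[OF assms(1), of k] psum_eventually[of "map (min k) lam" L] assms(2)
    by (simp add: psum_eq_sum)
qed

text \<open>The rows of \<open>mu\<close> from \<open>l\<close> to \<open>Suc l + 2 * m\<close> have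
  a common length \<open>t\<close>; in \<open>lam\<close> the first two of them have length
  \<open>t + 1\<close> and the last two \<open>t - 1\<close>. Within the first \<open>k\<close>
  columns the gain of 2 (for \<open>t < k\<close>) and the loss of 2 (for \<open>t \<le> k\<close>)
  cancel except at \<open>k = t\<close>.\<close>

lemma conjugate_lower_interval:
  assumes lam: "special_partition X N lam" and mu: "special_partition X N mu"
    and T: "halfsum X mu = (\<lambda>k. halfsum X lam k - of_bool (Suc l \<le> k \<and> k \<le> Suc l + 2 * m))"
    and m: "0 < m" and alt: "alternating X (halfsum X lam) (Suc l) m"
    and inner: "Suc l mod 2 \<noteq> eps' X"
  obtains t where "t mod 2 = eps X" "0 < t"
    "halfsum (d_type X) (conjugate lam) = (\<lambda>k. halfsum (d_type X) (conjugate mu) k - of_bool (k = t))"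
proof -
  let ?T = "halfsum X lam" and ?T' = "halfsum X mu"
  let ?I = "\<lambda>k. Suc l \<le> k \<and> k \<le> Suc l + 2 * m"
  have def': "defect X ?T' k = defect X ?T k - of_bool (k = Suc l \<or> k = Suc l + 2 * m)
      + of_bool (k = l \<or> k = Suc (Suc l + 2 * m))" if "0 < k" for k
    unfolding T defect_diff[OF that] using that m by (auto simp: of_bool_def)
  have alt_lam: "defect X ?T (Suc l + r) = of_bool (r = 0 \<or> r = 2 * m \<or> odd r)" if "r \<le> 2 * m" for r
    using alt that by (simp add: alternating_def)
  have alt_mu: "defect X ?T' (Suc l + r) = of_bool (odd r)" if "r \<le> 2 * m" for r
    using def'[of "Suc l + r"] alt_lam[OF that] that m by (auto simp: of_bool_def)
  have parity: "(Suc l + r) mod 2 = eps' X \<longleftrightarrow> odd r" for r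
    using inner eps_le_1(2)[of X] by presburger
  \<comment> \<open>Over the interval the defects of \<open>mu\<close> are 0 at inner and 1 at outer
    positions, so every drop vanishes.\<close>
  have rows_mu: "row mu (l + r) = row mu l" if "r \<le> Suc (2 * m)" for r
    using that
  proof (induction r)
    case (Suc r)
    have "2 * psum mu (Suc (l + r)) - psum mu (l + r) - psum mu (Suc (Suc (l + r))) = 0"
    proof (cases "odd r")
      case True
      then obtain q where q: "r = Suc q" by (cases r) auto
      have "r < 2 * m" using Suc.prems True by presburger
      then show ?thesis
        using expand_second_difference[of X ?T' "l + r"] parity[of r] True alt_mu[of r]
          alt_mu[of q] alt_mu[of "Suc r"] q
        by (simp add: psum_eq_expand[OF mu, symmetric])
    next
      case False
      then show ?thesis
        using expand_second_difference[of X ?T' "l + r"] parity[of r] alt_mu[of r] Suc.prems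
        by (simp add: psum_eq_expand[OF mu, symmetric])
    qed
    with Suc show ?case
      by (simp add: psum_Suc)
  qed simp
  define t where "t = row mu l"
  \<comment> \<open>The defect at the two ends, which are inner, falls from 1 to 0; this returns one
    of the two units.\<close>
  define E :: "nat \<Rightarrow> int" where
    "E k = of_bool (?I k) * (2 - of_bool (k = Suc l \<or> k = Suc l + 2 * m))" for k
  have E: "psum lam k = psum mu k + E k" for k
  proof (cases "?I k")
    case True
    then obtain r where r: "k = Suc l + r" "r \<le> 2 * m"
      using le_Suc_ex by (metis add_le_cancel_left)
    then show ?thesis
      unfolding psum_eq_expand[OF lam] psum_eq_expand[OF mu] expand_def
      using parity[of r] alt_lam[of r] alt_mu[of r] by (auto simp: T E_def of_bool_def)
  next
    case False
    have "defect X ?T' k = defect X ?T k" if "k mod 2 \<noteq> eps' X"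
    proof (cases "k = 0")
      case k: False
      have "k \<noteq> l" using inner that mod_2_neq_Suc by auto
      moreover have "k \<noteq> Suc (Suc l + 2 * m)" using that parity[of "Suc (2 * m)"] by auto
      ultimately show ?thesis
        using def'[of k] False k by auto
    qed (simp add: defect_def)
    with False show ?thesis
      unfolding psum_eq_expand[OF lam] psum_eq_expand[OF mu] expand_def by (auto simp: T E_def)
  qed
  have rows: "int (row lam i) = int (row mu i) + E (Suc i) - E i" for i
    using row_diff[of lam mu, OF E] .
  let ?up = "\<lambda>i. i = l \<or> i = Suc l" and ?down = "\<lambda>i. i = l + 2 * m \<or> i = Suc l + 2 * m"
  have Ediff: "E (Suc i) - E i = of_bool (?up i) - of_bool (?down i)" for i
    using m by (auto simp: E_def of_bool_def)
  have up: "row mu i = t" if "?up i" for i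
    using that rows_mu[of 0] rows_mu[of 1] by (auto simp: t_def)
  have down: "row mu i = t" if "?down i" for i
    using that rows_mu[of "2 * m"] rows_mu[of "Suc (2 * m)"] by (auto simp: t_def)
  have tpos: "0 < t"
    using rows[of "l + 2 * m"] Ediff[of "l + 2 * m"] down[of "l + 2 * m"] m by simp
  have g: "int (min k (row lam i)) = int (min k (row mu i)) +
      (of_bool (?up i) * of_bool (t < k) - of_bool (?down i) * of_bool (t \<le> k))" for i k
  proof -
    have "\<not> (?up i \<and> ?down i)" using m by auto
    then consider "?up i" "\<not> ?down i" | "?down i" "\<not> ?up i" | "\<not> ?up i" "\<not> ?down i"
      by blast
    then show ?thesis
    proof cases
      case 1
      then have "row lam i = Suc t" "row mu i = t"
        using rows[of i] Ediff[of i] up[of i] by auto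
      with 1 show ?thesis by auto
    next
      case 2
      then have "int (row lam i) = int t - 1" "row mu i = t"
        using rows[of i] Ediff[of i] down[of i] by auto
      with 2 show ?thesis by auto
    next
      case 3
      then have "row lam i = row mu i"
        using rows[of i] Ediff[of i] by auto
      with 3 show ?thesis by auto
    qed
  qed
  have S: "psum (conjugate lam) k = psum (conjugate mu) k - 2 * of_bool (k = t)" for k
  proof -
    define L where "L = max (length lam) (max (length mu) (Suc (Suc l + 2 * m)))"
    have L: "length lam \<le> L" "length mu \<le> L" "Suc l + 2 * m < L"
      by (auto simp: L_def)
    have "psum (conjugate lam) k = psum (conjugate mu) k +
        (\<Sum>i<L. of_bool (?up i) * of_bool (t < k) - of_bool (?down i) * of_bool (t \<le> k))"
      unfolding psum_conjugate_eq_sum[OF special_is_partition[OF lam] L(1)]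
        psum_conjugate_eq_sum[OF special_is_partition[OF mu] L(2)] g sum.distrib ..
    also have "(\<Sum>i<L. of_bool (?up i) * of_bool (t < k) - of_bool (?down i) * of_bool (t \<le> k) :: int)
        = (\<Sum>i<L. of_bool (?up i)) * of_bool (t < k) - (\<Sum>i<L. of_bool (?down i)) * of_bool (t \<le> k)"
      by (simp only: sum_subtractf sum_distrib_right)
    also have "(\<Sum>i<L. of_bool (?up i) :: int) = (\<Sum>i\<in>{l, Suc l}. 1)"
      using L(3) by (intro sum.mono_neutral_cong_right) auto
    also have "(\<Sum>i<L. of_bool (?down i) :: int) = (\<Sum>i\<in>{l + 2 * m, Suc l + 2 * m}. 1)"
      using L(3) by (intro sum.mono_neutral_cong_right) auto
    finally show ?thesis
      by auto
  qed
  have "psum mu (Suc (Suc l)) - psum mu (Suc l) = 2 * (?T' (Suc (Suc l)) - ?T' (Suc l)) - int (eps X)"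
    unfolding psum_eq_expand[OF mu] expand_def
    using parity[of 0] parity[of 1] alt_mu[of 0] by simp
  then have "int t = 2 * (?T' (Suc (Suc l)) - ?T' (Suc l)) - int (eps X)"
    using up[of "Suc l"] by (simp add: psum_Suc)
  then have "t mod 2 = eps X"
    using eps_le_1(1)[of X] by presburger
  moreover have "halfsum (d_type X) (conjugate lam)
      = (\<lambda>k. halfsum (d_type X) (conjugate mu) k - of_bool (k = t))"
    by (rule ext) (simp add: halfsum_def S)
  ultimately show ?thesis
    using tpos that by blast
qed

section \<open>Quartets\<close>

definition quartet :: "degeneration \<Rightarrow> bool" where
  "quartet p \<longleftrightarrow> (\<exists>n \<ge> 1.
     \<exists>(t, t_f, t_d, t_LS) \<in>
       {(Sing_C n, Sing_B n, Sing_c_sp n, Sing_b_sp n),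
        (Sing_C n, Sing_C_star (n + 1), Sing_c_sp n, Sing_d_plus (n + 1)),
        (Sing_C n, Sing_2B_plus n, Sing_c_sp n, Sing_d_mod_V4 (n + 1))}.
       has_singularity p t \<and> has_singularity (f_deg p) t_f \<and>
       has_singularity (d_deg p) t_d \<and> has_singularity (d_LS_deg p) t_LS)"

lemma eps_d_type_parity:
  "k mod 2 = eps (d_type X) \<longleftrightarrow> k mod 2 \<noteq> eps' X"
  "k mod 2 = eps' (d_type X) \<longleftrightarrow> k mod 2 \<noteq> eps X"
  by (cases X; simp add: mod2_eq_if)+

text \<open>An inner position gives type \<open>C_n\<close>. \<open>f\<close> keeps the sequence but
  makes the position outer, so \<open>reduces_outer\<close> supplies the possible types of
  \<open>f p\<close>; conjugating the reduced pairs gives the other two types.\<close>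

lemma quartet_inner:
  assumes lam: "special_partition X N lam" and mu: "special_partition X N mu"
    and T: "halfsum X mu = (\<lambda>k. halfsum X lam k - of_bool (k = Suc l))"
    and inner: "Suc l mod 2 \<noteq> eps' X"
  shows "quartet (X, lam, mu)"
proof -
  let ?Y = "f_type X" and ?nu = "f_map X lam" and ?kap = "f_map X mu"
  have "0 \<le> defect X (halfsum X mu) (Suc l)"
    using special_admissible[OF mu] by (auto simp: admissible_def)
  then have "2 \<le> defect X (halfsum X lam) (Suc l)"
    unfolding T by (simp add: defect_def)
  then obtain n where d: "defect X (halfsum X lam) (Suc l) = int n + 1" and n: "1 \<le> n"
    by (intro that[of "nat (defect X (halfsum X lam) (Suc l) - 1)"]) simp_all
  let ?p = "(X, lam, mu)"
  have l: "l mod 2 = eps' X"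
    using inner mod_2_neq_Suc by blast
  obtain s where s: "s mod 2 \<noteq> eps X"
    and red: "reduces l s [2 * n] (if n = 1 then [1, 1] else [2 * n - 2, 2]) lam mu"
    using reduces_inner[OF lam mu T inner d n] by blast
  have C: "has_singularity ?p (Sing_C n)"
  proof (rule has_singularityI[OF red])
    show "reduced_singularity X l s [2 * n] (if n = 1 then [1, 1] else [2 * n - 2, 2]) (Sing_C n)"
      using C_1[of X l s] C_n[of n s X l] s l n by auto
  qed
  have c: "has_singularity (d_deg ?p) (Sing_c_sp n)"
  proof (cases "n = 1")
    case True
    have "conjugate [2] = [1, 1]" "conjugate [1, 1] = [2]"
      using conjugate_row[of 2] conjugate_two_rows[of 1] by (simp_all add: numeral_2_eq_2)
    with reduces_conjugate[OF red] True have "reduces s l [2] [1, 1] (conjugate mu) (conjugate lam)"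
      by simp
    from has_singularityI[OF this c_1_sp[OF C_1]] True show ?thesis
      by simp
  next
    case False
    with n have n2: "2 \<le> n" by simp
    have "l mod 2 \<noteq> eps (d_type X)"
      using l eps_d_type_parity(1) by blast
    then have "reduced_singularity (d_type X) s l ([2, 2] @ replicate (2 * n - 4) 1) (replicate (2 * n) 1) (Sing_c_sp n)"
      using n2 by (intro c_n_sp)
    moreover have "conjugate [2 * n - 2, 2] = [2, 2] @ replicate (2 * n - 4) 1"
      using conjugate_row_2[of "2 * n - 2"] n2 by simp
    then have "reduces s l ([2, 2] @ replicate (2 * n - 4) 1) (replicate (2 * n) 1) (conjugate mu) (conjugate lam)"
      using reduces_conjugate[OF red] False conjugate_row[of "2 * n"] by simp
    ultimately show ?thesis
      using has_singularityI unfolding d_deg.simps by blast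
  qed
  note nu = f_map_special[OF lam] and kap = f_map_special[OF mu]
  have fT: "halfsum ?Y ?kap = (\<lambda>k. halfsum ?Y ?nu k - of_bool (k = Suc l))"
    by (simp add: halfsum_f_map[OF lam] halfsum_f_map[OF mu] T)
  have bd: "Suc l mod 2 = eps' ?Y"
    using inner by (cases X) (simp_all add: mod2_eq_if split: if_splits)
  have fd: "defect ?Y (halfsum ?Y ?nu) (Suc l) = int n + 1"
    by (simp add: halfsum_f_map[OF lam] d)
  have lY: "l mod 2 \<noteq> eps' ?Y"
    using bd mod_2_neq_Suc by blast
  \<comment> \<open>Transposition turns common rows into common columns, whose parity is compared
    with \<open>eps (d_type ?Y)\<close>.\<close>
  then have lD: "l mod 2 = eps (d_type ?Y)"
    using eps_d_type_parity(1) by blast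
  let ?q = "(?Y, ?nu, ?kap)"
  have q: "f_deg ?p = ?q" "d_LS_deg ?p = d_deg ?q"
    by (simp_all add: d_LS_deg_eq)
  have dsing: "has_singularity (d_deg ?q) t"
    if "reduces l s a b ?nu ?kap" "reduced_singularity (d_type ?Y) s l (conjugate b) (conjugate a) t"
    for l s a b t
    using has_singularityI[OF reduces_conjugate[OF that(1)] that(2)] by simp
  have "has_singularity ?q (Sing_B n) \<and> has_singularity (d_deg ?q) (Sing_b_sp n) \<or>
    has_singularity ?q (Sing_C_star (n + 1)) \<and> has_singularity (d_deg ?q) (Sing_d_plus (n + 1)) \<or>
    has_singularity ?q (Sing_2B_plus n) \<and> has_singularity (d_deg ?q) (Sing_d_mod_V4 (n + 1))"
    using nu kap fT bd fd n
  proof (cases rule: reduces_outer)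
    case (1 s)
    have "has_singularity ?q (Sing_C_star (n + 1))"
      using C_n_star[of "n + 1" s ?Y l] 1 n lY by (intro has_singularityI[OF 1(2)]) simp
    moreover have "has_singularity (d_deg ?q) (Sing_d_plus (n + 1))"
      using d_n_plus[of "n + 1" l "d_type ?Y" s] n lD conjugate_row[of "2 * n + 2"] conjugate_row_2[of "2 * n"]
      by (intro dsing[OF 1(2)]) simp
    ultimately show ?thesis by blast
  next
    case (2 s)
    have "has_singularity ?q (Sing_B n)"
      using B_n_row[of n s ?Y l] 2 n by (intro has_singularityI[OF 2(2)]) simp
    moreover have "has_singularity (d_deg ?q) (Sing_b_sp n)"
    proof (rule dsing[OF 2(2)])
      have conj: "conjugate [2 * n - 1, 1, 1] = 3 # replicate (2 * n - 2) 1"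
        "conjugate [2 * n + 1] = replicate (2 * n + 1) 1"
        using n conjugate_hook[of "2 * n - 1"] conjugate_row[of "2 * n + 1"] by simp_all
      show "reduced_singularity (d_type ?Y) s l (conjugate [2 * n - 1, 1, 1]) (conjugate [2 * n + 1]) (Sing_b_sp n)"
        unfolding conj
      \<comment> \<open>For \<open>n = 1\<close> the pair is \<open>([3], [1, 1, 1])\<close> of type
        \<open>B_1\<close>, identified with special \<open>b_1\<close>.\<close>
      proof (cases "n = 1")
        case True
        then show "reduced_singularity (d_type ?Y) s l (3 # replicate (2 * n - 2) 1)
            (replicate (2 * n + 1) 1) (Sing_b_sp n)"
          using b_1_sp[OF B_n_row[of 1 l "d_type ?Y" s]] lD
          by (simp add: numeral_3_eq_3)
      next
        case False
        then show "reduced_singularity (d_type ?Y) s l (3 # replicate (2 * n - 2) 1)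
            (replicate (2 * n + 1) 1) (Sing_b_sp n)"
          using n lD by (intro b_n_sp_one) auto
      qed
    qed
    ultimately show ?thesis by blast
  next
    case (3 s l')
    have l': "l' mod 2 \<noteq> eps (d_type ?Y)"
      using lY 3(1) mod_2_neq_Suc eps_d_type_parity(1) by blast
    have "has_singularity ?q (Sing_B n)"
      using B_n_two_rows[of n s ?Y l'] 3 n by (intro has_singularityI[OF 3(3)]) simp
    moreover have "has_singularity (d_deg ?q) (Sing_b_sp n)"
    proof (rule dsing[OF 3(3)])
      have conj: "conjugate [2 * n, 2 * n, 2] = [3, 3] @ replicate (2 * n - 2) 2"
        "conjugate [2 * n + 1, 2 * n + 1] = replicate (2 * n + 1) 2"
        using n conjugate_two_rows_2[of "2 * n"] conjugate_two_rows[of "2 * n + 1"] by simp_all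
      show "reduced_singularity (d_type ?Y) s l' (conjugate [2 * n, 2 * n, 2])
          (conjugate [2 * n + 1, 2 * n + 1]) (Sing_b_sp n)"
        unfolding conj
      proof (cases "n = 1")
        case True
        then show "reduced_singularity (d_type ?Y) s l' ([3, 3] @ replicate (2 * n - 2) 2)
            (replicate (2 * n + 1) 2) (Sing_b_sp n)"
          using b_1_sp[OF B_n_two_rows[of 1 l' "d_type ?Y" s]] l'
          by (simp add: numeral_3_eq_3)
      next
        case False
        then show "reduced_singularity (d_type ?Y) s l' ([3, 3] @ replicate (2 * n - 2) 2)
            (replicate (2 * n + 1) 2) (Sing_b_sp n)"
          using n l' by (intro b_n_sp_two) auto
      qed
    qed
    ultimately show ?thesis by blast
  next
    case (4 s l')
    have l': "l' mod 2 \<noteq> eps (d_type ?Y)"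
      using lY 4(1) mod_2_neq_Suc eps_d_type_parity(1) by blast
    have s: "s mod 2 \<noteq> eps' (d_type ?Y)"
      using 4(2) eps_d_type_parity(2) by blast
    have "has_singularity ?q (Sing_2B_plus n)"
      using two_B_n[of n s ?Y l'] 4 n by (intro has_singularityI[OF 4(3)]) simp
    moreover have "has_singularity (d_deg ?q) (Sing_d_mod_V4 (n + 1))"
    proof (rule dsing[OF 4(3)])
      have conj: "conjugate [2 * n - 1, 2 * n - 1, 1, 1] = 4 # replicate (2 * n - 2) 2"
        "conjugate [2 * n, 2 * n] = replicate (2 * n) 2"
        using n conjugate_double_hook[of "2 * n - 1"] conjugate_two_rows[of "2 * n"] by simp_all
      show "reduced_singularity (d_type ?Y) s l' (conjugate [2 * n - 1, 2 * n - 1, 1, 1])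
          (conjugate [2 * n, 2 * n]) (Sing_d_mod_V4 (n + 1))"
        unfolding conj
      \<comment> \<open>For \<open>n = 1\<close> the pair is \<open>([4], [2, 2])\<close> and
        \<open>d_2/V_4\<close> is read as \<open>C_2^*\<close>; this uses the parity of
        \<open>s\<close>, now the number of common rows.\<close>
      proof (cases "n = 1")
        case True
        then show "reduced_singularity (d_type ?Y) s l' (4 # replicate (2 * n - 2) 2)
            (replicate (2 * n) 2) (Sing_d_mod_V4 (n + 1))"
          using d_2_mod_V4[OF C_n_star[of 2 l' "d_type ?Y" s]] l' s
          by (simp add: numeral_eq_Suc)
      next
        case False
        then show "reduced_singularity (d_type ?Y) s l' (4 # replicate (2 * n - 2) 2)
            (replicate (2 * n) 2) (Sing_d_mod_V4 (n + 1))"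
          using n l' by (intro d_mod_V4) auto
      qed
    qed
    ultimately show ?thesis by blast
  qed
  with C c n show ?thesis
    unfolding quartet_def q by (intro exI[of _ n]) auto
qed

text \<open>Transposition turns the interval cover into a lowering at a single inner position, to
  which \<open>quartet_inner\<close> applies.\<close>

lemma quartet_conjugate:
  assumes lam: "special_partition X N lam" and mu: "special_partition X N mu"
    and T: "halfsum X mu = (\<lambda>k. halfsum X lam k - of_bool (Suc l \<le> k \<and> k \<le> Suc l + 2 * m))"
    and m: "0 < m" and alt: "alternating X (halfsum X lam) (Suc l) m"
    and inner: "Suc l mod 2 \<noteq> eps' X"
  shows "quartet (d_deg (X, lam, mu))"
proof -
  obtain t where t: "t mod 2 = eps X" "0 < t"
    "halfsum (d_type X) (conjugate lam) = (\<lambda>k. halfsum (d_type X) (conjugate mu) k - of_bool (k = t))"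
    using conjugate_lower_interval[OF assms] by blast
  obtain s where s: "t = Suc s"
    using t(2) gr0_implies_Suc by blast
  have "Suc s mod 2 \<noteq> eps' (d_type X)"
    using t(1) s eps_d_type_parity(2) by blast
  from quartet_inner[OF special_conjugate[OF mu] special_conjugate[OF lam] t(3)[unfolded s] this]
  have "quartet (d_type X, conjugate mu, conjugate lam)" .
  then show ?thesis by simp
qed

lemma eps'_f_type_parity: "k mod 2 \<noteq> eps' (f_type X) \<longleftrightarrow> k mod 2 = eps' X"
  by (cases X; simp add: mod2_eq_if)

theorem proposition7p3:
  fixes X :: lie_type and lam mu :: "nat list" and p0 :: degeneration
  assumes "p0 = (X, lam, mu)"
    and "minimal_special_degeneration p0"
  shows "(\<forall>p \<in> {p0, f_deg p0, d_deg p0, d_LS_deg p0}. minimal_special_degeneration p) \<and>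
    (\<exists>p \<in> {p0, f_deg p0, d_deg p0, d_LS_deg p0}. \<exists>n \<ge> 1.
       \<exists>(t, t_f, t_d, t_LS) \<in>
         {(Sing_C n, Sing_B n, Sing_c_sp n, Sing_b_sp n),
          (Sing_C n, Sing_C_star (n + 1), Sing_c_sp n, Sing_d_plus (n + 1)),
          (Sing_C n, Sing_2B_plus n, Sing_c_sp n, Sing_d_mod_V4 (n + 1))}.
         has_singularity p t \<and> has_singularity (f_deg p) t_f \<and>
         has_singularity (d_deg p) t_d \<and> has_singularity (d_LS_deg p) t_LS)"
  unfolding quartet_def[symmetric]
proof (intro conjI ballI)
  fix p assume "p \<in> {p0, f_deg p0, d_deg p0, d_LS_deg p0}"
  then show "minimal_special_degeneration p"
    using assms(2) minimal_special_degeneration_f[OF assms(2)] minimal_special_degeneration_d[OF assms(2)]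
      minimal_special_degeneration_d[OF minimal_special_degeneration_f[OF assms(2)]]
    unfolding d_LS_deg_eq by blast
next
  obtain N n where lam: "special_partition X N lam" and mu: "special_partition X N mu"
    and n: "int N = 2 * int n + unit_B X" and cov: "covers X n (halfsum X lam) (halfsum X mu)"
    using assms minimal_special_degeneration_iff by blast
  note f = f_map_special[OF lam] f_map_special[OF mu]
  note fT = halfsum_f_map[OF lam] halfsum_f_map[OF mu]
  \<comment> \<open>The kind of the cover and the parity of its first position select the initial
    degeneration: \<open>p0\<close> or \<open>f_deg p0\<close> for a single lowering,
    \<open>d_deg p0\<close> or \<open>d_LS_deg p0\<close> for an interval.\<close>
  show "\<exists>p\<in>{p0, f_deg p0, d_deg p0, d_LS_deg p0}. quartet p"
    using special_admissible'[OF lam n] special_admissible'[OF mu n] cov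
  proof (cases rule: covers_cases)
    case (1 k)
    then obtain l where l: "k = Suc l"
      using gr0_implies_Suc by blast
    show ?thesis
    proof (cases "Suc l mod 2 = eps' X")
      case False
      with quartet_inner[OF lam mu] 1 l assms(1) show ?thesis by auto
    next
      case True
      \<comment> \<open>\<open>f\<close> keeps the sequence and exchanges inner and outer
        positions.\<close>
      then have "Suc l mod 2 \<noteq> eps' (f_type X)"
        using eps'_f_type_parity by blast
      then have "quartet (f_type X, f_map X lam, f_map X mu)"
        using 1 l by (intro quartet_inner[OF f, of l]) (simp_all add: fT)
      with assms(1) show ?thesis by auto
    qed
  next
    case (2 p m)
    then obtain l where l: "p = Suc l"
      using gr0_implies_Suc by blast
    show ?thesis
    proof (cases "Suc l mod 2 = eps' X")
      case False
      with quartet_conjugate[OF lam mu] 2 l assms(1) show ?thesis by blast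
    next
      case True
      then have "Suc l mod 2 \<noteq> eps' (f_type X)"
        using eps'_f_type_parity by blast
      then have "quartet (d_deg (f_type X, f_map X lam, f_map X mu))"
        using 2 l by (intro quartet_conjugate[OF f, of l m]) (simp_all add: fT alternating_def)
      with assms(1) show ?thesis
        unfolding d_LS_deg_eq by auto
    qed
  qed
qed

end
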